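(* For each $k\in\mathcal K$, the linear minimum mean-square error (LMMSE) estimate of the uplink cascaded channel $\tilde{\mathbf u}_k$ from the noisy observation $\tilde{\mathbf r}_k$ is $$\hat{\tilde{\mathbf u}}_k=\tilde{\mathbf R}_k\tilde{\mathbf Q}_k\tilde{\mathbf r}_k,\qquad \tilde{\mathbf Q}_k=\Big(\tilde{\mathbf R}_k+\frac{\sigma_{\mathrm u}^2}{\tau_{\mathrm{up}}p_{\mathrm{Train}}}\mathbf I_{M_{\mathrm R}}\Big)^{-1}.$$
   Context: $(\cdot)^{\mathsf H}$ is conjugate transpose, $\mathrm{Tr}$ the trace, $\mathcal{CN}$ the circularly symmetric complex Gaussian law. $\mathcal K=\{1,\dots,K\}$ indexes users. $\tilde{\mathbf R}_{\mathrm b}\in\mathbb C^{M_{\mathrm R}\times M_{\mathrm R}}$ and $\mathbf R_{\mathrm s}\in\mathbb C^{N\times N}$ are deterministic Hermitian positive semidefinite matrices, $\tilde\delta_g,\tilde\delta_{h_k}>0$, and $\boldsymbol\Theta_{\mathrm r}\in\mathbb C^{N\times N}$ is a deterministic diagonal matrix. Let $\tilde{\mathbf G}=\sqrt{\tilde\delta_g}\,\tilde{\mathbf R}_{\mathrm b}^{1/2}\tilde{\mathbf D}\mathbf R_{\mathrm s}^{1/2}$ and $\tilde{\mathbf h}_k=\sqrt{\tilde\delta_{h_k}}\,\mathbf R_{\mathrm s}^{1/2}\tilde{\mathbf c}_k$, where $\tilde{\mathbf D}\in\mathbb C^{M_{\mathrm R}\times N}$ and $\tilde{\mathbf c}_k\in\mathbb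 C^{N}$ are independent with i.i.d. $\mathcal{CN}(0,1)$ entries. The uplink cascaded channel is $\tilde{\mathbf u}_k=\tilde{\mathbf G}\boldsymbol\Theta_{\mathrm r}\tilde{\mathbf h}_k$, with covariance $\tilde{\mathbf R}_k=\mathbb E\{\tilde{\mathbf u}_k\tilde{\mathbf u}_k^{\mathsf H}\}=\tilde\delta_g\tilde\delta_{h_k}\mathrm{Tr}(\mathbf R_{\mathrm s}\boldsymbol\Theta_{\mathrm r}\mathbf R_{\mathrm s}\boldsymbol\Theta_{\mathrm r}^{\mathsf H})\tilde{\mathbf R}_{\mathrm b}$. Users send orthogonal pilots $\tilde{\mathbf x}_{\mathrm pk}\in\mathbb C^{\tau_{\mathrm{up}}}$ with $\tilde{\mathbf x}_{\mathrm pk}^{\mathsf H}\tilde{\mathbf x}_{\mathrm pl}=0$ for $k\ne l$ and $\tilde{\mathbf x}_{\mathrm pk}^{\mathsf H}\tilde{\mathbf x}_{\mathrm pk}=\tau_{\mathrm{up}}p_{\mathrm{Train}}>0$. The base station receives $\mathbf Y_{\mathrm u}=\sum_{i\in\mathcal K}\tilde{\mathbf u}_i\tilde{\mathbf x}_{\mathrm pi}^{\mathsf H}+\tilde{\mathbf W}$, where $\tilde{\mathbf W}\in\mathbb C^{M_{\mathrm R}\times\tau_{\mathrm{up}}}$ is independent of the channels and has independent $\mathcal{CN}(\mathbf 0,\sigma_{\mathrm u}^2\mathbf I_{M_{\mathrm R}})$ columns with $\sigma_{\mathrm u}^2>0$, and forms $\tilde{\mathbf r}_k=\frac{1}{\tau_{\mathrm{up}}p_{\mathrm{Train}}}\mathbf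 Y_{\mathrm u}\tilde{\mathbf x}_{\mathrm pk}=\tilde{\mathbf u}_k+\frac{\tilde{\mathbf W}\tilde{\mathbf x}_{\mathrm pk}}{\tau_{\mathrm{up}}p_{\mathrm{Train}}}$. The LMMSE estimate of $\tilde{\mathbf u}_k$ from $\tilde{\mathbf r}_k$ is $\mathbf M\tilde{\mathbf r}_k$ with the matrix $\mathbf M\in\mathbb C^{M_{\mathrm R}\times M_{\mathrm R}}$ minimizing $\mathbb E\{\|\tilde{\mathbf u}_k-\mathbf M\tilde{\mathbf r}_k\|^2\}$. *)

theory Defs
  imports "HOL-Probability.Probability"
begin

definition ctranspose :: "complex^'n^'m \<Rightarrow> complex^'m^'n" where
  "ctranspose A = (\<chi> i j. cnj (A $ j $ i))"

definition cinner :: "complex^'n \<Rightarrow> complex^'n \<Rightarrow> complex" where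
  "cinner x y = (\<Sum>i\<in>UNIV. cnj (x $ i) * y $ i)"

(* The rank-one matrix u v^H. *)
definition outer :: "complex^'m \<Rightarrow> complex^'n \<Rightarrow> complex^'n^'m" where
  "outer u v = (\<chi> i j. u $ i * cnj (v $ j))"

definition cscale :: "complex \<Rightarrow> complex^'n^'m \<Rightarrow> complex^'n^'m" where
  "cscale z A = (\<chi> i j. z * A $ i $ j)"

(* For a Hermitian A the quadratic form is real, so taking Re loses nothing. *)
definition psd :: "complex^'n^'n \<Rightarrow> bool" where
  "psd A \<longleftrightarrow> ctranspose A = A \<and> (\<forall>x. 0 \<le> Re (cinner x (A *v x)))"

definition diagonal_matrix :: "complex^'n^'n \<Rightarrow> bool" where
  "diagonal_matrix A \<longleftrightarrow> (\<forall>i j. i \<noteq> j \<longrightarrow> A $ i $ j = 0)"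

(* A positive semidefinite A has exactly one positive semidefinite square root,
   so the choice is determined for every such A; other arguments are irrelevant. *)
definition psd_sqrt :: "complex^'n^'n \<Rightarrow> complex^'n^'n" where
  "psd_sqrt A = (SOME S. psd S \<and> S ** S = A)"

(* The library's indep_var requires both variables to take values in the same type. *)
definition indep_rvs ::
  "'w measure \<Rightarrow> ('w \<Rightarrow> 'a::topological_space) \<Rightarrow> ('w \<Rightarrow> 'b::topological_space) \<Rightarrow> bool" where
  "indep_rvs P X Y \<longleftrightarrow>
     X \<in> borel_measurable P \<and> Y \<in> borel_measurable P \<and>
     prob_space.indep_set P
       {X -` A \<inter> space P | A. A \<in> sets borel} {Y -` B \<inter> space P | B. B \<in> sets borel}"

(* CN(0,1): real and imaginary parts are independent N(0,1/2). *)
definition std_complex_normal :: "complex measure" where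
  "std_complex_normal = density lborel (\<lambda>z. ennreal (exp (- (cmod z)\<^sup>2) / pi))"

(* CN(0,C) for a positive semidefinite, possibly singular, covariance C: the law of
   C^(1/2) g, where g has i.i.d. CN(0,1) entries. *)
definition complex_normal :: "complex^'m^'m \<Rightarrow> (complex^'m) measure" where
  "complex_normal C =
     distr (Pi\<^sub>M UNIV (\<lambda>_. std_complex_normal)) borel (\<lambda>g. psd_sqrt C *v (\<chi> i. g i))"

(* The mean-square error is taken in [0,\<infinity>], so it is meaningful without any
   integrability assumption. *)
definition mean_square_error ::
  "'w measure \<Rightarrow> ('w \<Rightarrow> complex^'m) \<Rightarrow> ('w \<Rightarrow> complex^'n) \<Rightarrow> complex^'n^'m \<Rightarrow> ennreal" where
  "mean_square_error P u r M = (\<integral>\<^sup>+ \<omega>. ennreal ((norm (u \<omega> - M *v r \<omega>))\<^sup>2) \<partial>P)"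

definition is_lmmse_matrix ::
  "'w measure \<Rightarrow> ('w \<Rightarrow> complex^'m) \<Rightarrow> ('w \<Rightarrow> complex^'n) \<Rightarrow> complex^'n^'m \<Rightarrow> bool" where
  "is_lmmse_matrix P u r M \<longleftrightarrow>
     (\<forall>M'. mean_square_error P u r M \<le> mean_square_error P u r M')"

definition is_lmmse_estimate ::
  "'w measure \<Rightarrow> ('w \<Rightarrow> complex^'m) \<Rightarrow> ('w \<Rightarrow> complex^'n) \<Rightarrow> ('w \<Rightarrow> complex^'m) \<Rightarrow> bool" where
  "is_lmmse_estimate P u r u_hat \<longleftrightarrow>
     (\<exists>M. is_lmmse_matrix P u r M \<and> u_hat = (\<lambda>\<omega>. M *v r \<omega>))"

end

theory Submission
  imports Defs
begin

text \<open>
  The channel is \<open>u\<^sub>k = A D T c\<^sub>k\<close> with \<open>D\<close> and \<open>c\<^sub>k\<close> independent and white, where \<open>A\<close> is a multiple of the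
  square root of \<open>R\<^sub>b\<close> and \<open>T\<close> one of \<open>R\<^sub>s\<^sup>1\<^sup>/\<^sup>2 \<Theta> R\<^sub>s\<^sup>1\<^sup>/\<^sup>2\<close>. Conditioning on \<open>c\<^sub>k\<close> gives
  \<open>E u\<^sub>k u\<^sub>k\<^sup>H = tr(T T\<^sup>H) A A\<^sup>H\<close>. By orthogonality of the pilots \<open>r\<^sub>k = u\<^sub>k + n\<close>, where \<open>n\<close> has
  mean zero, is independent of \<open>u\<^sub>k\<close> and has covariance \<open>\<sigma>\<^sup>2 / (\<tau> p) I\<close>. Hence \<open>E u\<^sub>k r\<^sub>k\<^sup>H = R\<^sub>k\<close> and
  \<open>E r\<^sub>k r\<^sub>k\<^sup>H = R\<^sub>k + \<sigma>\<^sup>2 / (\<tau> p) I\<close> is invertible, and the orthogonality principle yields the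
  estimator together with its uniqueness.
\<close>

section \<open>Complex matrices and positive semidefinite square roots\<close>

text \<open>\<open>psd_sqrt\<close> is a choice, so nothing can be computed with the channel before
  a root is known to exist. The existence proof avoids spectral decomposition: a Banach fixed point
  treats definite matrices, and compactness carries the result to semidefinite ones. The
  distributions enter afterwards through means and second moments, together with independence. A
  Bochner integral of a non-integrable function is 0 by default, so square integrability is carried
  along throughout: it makes each covariance a genuine moment and keeps the mean-square error, an
  extended real, finite. One computation, a white random matrix applied to an independent vector,
  serves twice: for \<open>D\<close> applied to the transformed \<open>c k\<close>, and for the
  noise matrix applied to a fixed scaled pilot.\<close>

lemma inner_eq_Re_cinner: "x \<bullet> y = Re (cinner x y)"
  by (simp add: inner_vec_def cinner_def inner_complex_def)

lemma cinner_adjoint: "cinner (A *v x) y = cinner x (ctranspose A *v y)"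
proof -
  have "cinner (A *v x) y = (\<Sum>i\<in>UNIV. \<Sum>j\<in>UNIV. cnj (A $ i $ j) * cnj (x $ j) * y $ i)"
    by (simp add: cinner_def matrix_vector_mult_def sum_distrib_right)
  also have "\<dots> = (\<Sum>j\<in>UNIV. \<Sum>i\<in>UNIV. cnj (A $ i $ j) * cnj (x $ j) * y $ i)"
    by (rule sum.swap)
  also have "\<dots> = cinner x (ctranspose A *v y)"
    by (simp add: cinner_def matrix_vector_mult_def ctranspose_def sum_distrib_left mult_ac)
  finally show ?thesis .
qed

lemma inner_adjoint: "(A *v x) \<bullet> y = x \<bullet> (ctranspose A *v y)" for A :: "complex^'n^'m"
  by (simp add: inner_eq_Re_cinner cinner_adjoint)

lemma ctranspose_eqI:
  fixes A :: "complex^'n^'m"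
  assumes "\<And>x y. (A *v x) \<bullet> y = x \<bullet> (B *v y)"
  shows "ctranspose A = B"
proof -
  have "ctranspose A *v y = B *v y" for y
    using assms by (metis inner_adjoint vector_eq_ldot)
  then show ?thesis by (simp add: matrix_eq)
qed

text \<open>The conjugate transpose is also the adjoint for the real inner product, and that inner
  product separates vectors. Being Hermitian can therefore be tested in the real Euclidean
  structure, where norms and operator estimates are available.\<close>

lemma psd_iff_inner:
  "psd A \<longleftrightarrow> (\<forall>x y. (A *v x) \<bullet> y = x \<bullet> (A *v y)) \<and> (\<forall>x. 0 \<le> x \<bullet> (A *v x))"
proof -
  have "ctranspose A = A \<longleftrightarrow> (\<forall>x y. (A *v x) \<bullet> y = x \<bullet> (A *v y))"
    using ctranspose_eqI[of A A] inner_adjoint[of A] by auto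
  then show ?thesis by (simp add: psd_def inner_eq_Re_cinner)
qed

section \<open>Existence of positive semidefinite square roots\<close>

lemma matrix_vector_mult_vector_scalar: "A *v (s *s x) = s *s (A *v x)" for A :: "complex^'n^'m"
  by (simp add: vec_eq_iff matrix_vector_mult_def sum_distrib_left mult_ac)

lemma scaleR_matrix_vector_mult: "(a *\<^sub>R A) *v x = a *\<^sub>R (A *v x)" for A :: "complex^'n^'m"
  by (simp add: vec_eq_iff matrix_vector_mult_def scaleR_sum_right)

text \<open>Rescaling brings a coercive operator within distance \<open>q < 1\<close> of the
  identity, which is where a square root can be found by iteration.\<close>

lemma posdef_contraction:
  fixes A :: "'a::euclidean_space \<Rightarrow>\<^sub>L 'a"
  assumes "\<epsilon> > 0" and pos: "\<And>x. \<epsilon> * (norm x)\<^sup>2 \<le> x \<bullet> A x"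
  obtains c q where "c > 0" "0 \<le> q" "q < 1" "norm (id_blinfun - (1 / c) *\<^sub>R A) \<le> q"
proof
  \<comment> \<open>The maximum provides \<open>L > 0\<close> and \<open>\<epsilon> \<le> L\<close>
    at once, so the radicand of \<open>q\<close> is nonnegative.\<close>
  define L where "L = max (norm A) \<epsilon>"
  have L: "L > 0" "\<epsilon> \<le> L" "norm A \<le> L" using \<open>\<epsilon> > 0\<close> by (auto simp: L_def)
  \<comment> \<open>The squared norm of \<open>x - t *\<^sub>R A x\<close> is at most
    \<open>1 - 2 * t * \<epsilon> + t\<^sup>2 * L\<^sup>2\<close> times that of \<open>x\<close>.
    This bound is smallest at \<open>t = \<epsilon> / L\<^sup>2\<close>, which is
    \<open>1 / c\<close>, and its value there is \<open>q\<^sup>2\<close>.\<close>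
  define c where "c = L\<^sup>2 / \<epsilon>"
  define q where "q = sqrt (1 - \<epsilon>\<^sup>2 / L\<^sup>2)"
  show "c > 0" using L \<open>\<epsilon> > 0\<close> by (simp add: c_def)
  have "\<epsilon>\<^sup>2 \<le> L\<^sup>2" using L \<open>\<epsilon> > 0\<close> by (intro power_mono) auto
  then show "0 \<le> q" using L by (simp add: q_def)
  show "q < 1" using L \<open>\<epsilon> > 0\<close> by (simp add: q_def)
  show "norm (id_blinfun - (1 / c) *\<^sub>R A) \<le> q"
  proof (rule norm_blinfun_bound[OF \<open>0 \<le> q\<close>])
    fix x
    have "norm (A x) \<le> L * norm x"
      by (meson L(3) norm_blinfun mult_right_mono norm_ge_zero order_trans)
    then have AL: "(norm (A x))\<^sup>2 \<le> L\<^sup>2 * (norm x)\<^sup>2"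
      by (metis norm_ge_zero power_mono power_mult_distrib)
    have "(norm (x - (1 / c) *\<^sub>R A x))\<^sup>2
        = (norm x)\<^sup>2 - 2 / c * (x \<bullet> A x) + (norm (A x))\<^sup>2 / c\<^sup>2"
      using dot_norm_neg[of x "(1 / c) *\<^sub>R A x"] by (simp add: power_divide)
    also have "\<dots> \<le> (norm x)\<^sup>2 - 2 / c * (\<epsilon> * (norm x)\<^sup>2) + L\<^sup>2 * (norm x)\<^sup>2 / c\<^sup>2"
      using pos[of x] AL \<open>c > 0\<close>
      by (intro add_mono diff_mono mult_left_mono divide_right_mono) auto
    also have "\<dots> = (q * norm x)\<^sup>2"
    proof -
      have "2 / c * (\<epsilon> * (norm x)\<^sup>2) = 2 * (\<epsilon>\<^sup>2 / L\<^sup>2 * (norm x)\<^sup>2)"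
        "L\<^sup>2 * (norm x)\<^sup>2 / c\<^sup>2 = \<epsilon>\<^sup>2 / L\<^sup>2 * (norm x)\<^sup>2"
        using L \<open>\<epsilon> > 0\<close> by (auto simp: c_def power2_eq_square)
      moreover have "q\<^sup>2 = 1 - \<epsilon>\<^sup>2 / L\<^sup>2"
        using L \<open>\<epsilon>\<^sup>2 \<le> L\<^sup>2\<close> by (simp add: q_def)
      ultimately show ?thesis
        by (simp only: power_mult_distrib left_diff_distrib) simp
    qed
    finally have "norm (x - (1 / c) *\<^sub>R A x) \<le> q * norm x"
      using \<open>0 \<le> q\<close> by (meson mult_nonneg_nonneg norm_ge_zero power2_le_imp_le)
    then show "norm ((id_blinfun - (1 / c) *\<^sub>R A) x) \<le> q * norm x"
      by (simp add: blinfun.bilinear_simps)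
  qed
qed

text \<open>For a contraction \<open>B\<close> the map \<open>X \<mapsto> (B + X\<^sup>2) / 2\<close> has a small fixed point \<open>X\<close>, and then
  \<open>(1 - X)\<^sup>2 = 1 - B\<close>.\<close>

lemma contraction_fixed_point:
  fixes B :: "'a::euclidean_space \<Rightarrow>\<^sub>L 'a"
  assumes q: "0 \<le> q" "q < 1" and Bq: "norm B \<le> q"
    and E: "closed E" "0 \<in> E" "B \<in> E"
      "\<And>X Y. X \<in> E \<Longrightarrow> Y \<in> E \<Longrightarrow> X + Y \<in> E" "\<And>a X. X \<in> E \<Longrightarrow> a *\<^sub>R X \<in> E"
      "\<And>X. X \<in> E \<Longrightarrow> X o\<^sub>L X \<in> E"
  obtains X where "X \<in> E" "norm X \<le> q" "(1/2) *\<^sub>R (B + (X o\<^sub>L X)) = X"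
proof -
  \<comment> \<open>The ball of radius \<open>q\<close> is mapped into itself because
    \<open>(q + q\<^sup>2) / 2 \<le> q\<close>. Intersecting with the closed set \<open>E\<close>
    lets algebraic properties of \<open>B\<close> survive in the fixed point.\<close>
  let ?S = "E \<inter> cball 0 q"
  let ?f = "\<lambda>X. (1/2) *\<^sub>R (B + (X o\<^sub>L X))"
  have "\<exists>!X\<in>?S. ?f X = X"
  proof (rule Banach_fix[of ?S q])
    show "Topological_Spaces.complete ?S" using E(1) by (intro closed_Int closed_cball complete_eq_closed[THEN iffD2])
    show "?S \<noteq> {}" using E(2) q by auto
    show "?f ` ?S \<subseteq> ?S"
    proof (rule image_subsetI)
      fix X assume "X \<in> ?S"
      then have X: "X \<in> E" "norm X \<le> q" by auto
      have "norm (X o\<^sub>L X) \<le> norm X * norm X" by (rule norm_blinfun_compose)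
      also have "\<dots> \<le> q * 1" using X q by (intro mult_mono) auto
      finally have "norm (B + (X o\<^sub>L X)) \<le> q + q" using Bq norm_triangle_mono by fastforce
      then show "?f X \<in> ?S"
        using E(3-6) X by auto
    qed
    show "dist (?f X) (?f Y) \<le> q * dist X Y" if "X \<in> ?S" "Y \<in> ?S" for X Y
    proof -
      have XY: "norm X \<le> q" "norm Y \<le> q" using that by auto
      \<comment> \<open>This splitting of \<open>X\<^sup>2 - Y\<^sup>2\<close> is valid without
        commutativity. Each summand is at most \<open>q\<close> times the distance, and the factor
        1/2 leaves \<open>q\<close> as Lipschitz constant.\<close>
      have "?f X - ?f Y = (1/2) *\<^sub>R ((X o\<^sub>L (X - Y)) + ((X - Y) o\<^sub>L Y))"
        by (rule blinfun_eqI) (simp add: blinfun.bilinear_simps algebra_simps)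
      moreover have "norm (X o\<^sub>L (X - Y)) \<le> q * norm (X - Y)"
        by (meson XY norm_blinfun_compose mult_right_mono norm_ge_zero order_trans)
      moreover have "norm ((X - Y) o\<^sub>L Y) \<le> norm (X - Y) * q"
        by (meson XY norm_blinfun_compose mult_left_mono norm_ge_zero order_trans)
      ultimately have "norm (?f X - ?f Y) \<le> (1/2) * (q * norm (X - Y) + norm (X - Y) * q)"
        using norm_triangle_mono by fastforce
      then show ?thesis by (simp add: dist_norm)
    qed
  qed (use q in auto)
  then show thesis using that by auto
qed

text \<open>Writing \<open>A / c\<close> as \<open>1 - B\<close> with \<open>B\<close> a
  contraction, the fixed point \<open>X\<close> satisfies \<open>(1 - X)\<^sup>2 = A / c\<close>, so
  the root is \<open>sqrt c\<close> times \<open>1 - X\<close>. It is nonnegative because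
  \<open>X\<close> has norm below 1.\<close>

lemma psd_sqrt_exists_posdef:
  fixes A :: "complex^'n^'n"
  assumes A: "psd A" and \<epsilon>: "\<epsilon> > 0" "\<And>x. \<epsilon> * (norm x)\<^sup>2 \<le> x \<bullet> (A *v x)"
  shows "\<exists>S. psd S \<and> S ** S = A"
proof -
  define F where "F = Blinfun ((*v) A)"
  have F: "blinfun_apply F = (*v) A" by (simp add: F_def bounded_linear_Blinfun_apply)
  obtain c q where c: "c > 0" and q: "0 \<le> q" "q < 1" "norm (id_blinfun - (1 / c) *\<^sub>R F) \<le> q"
    using posdef_contraction[of \<epsilon> F] \<epsilon> F by auto
  let ?B = "id_blinfun - (1 / c) *\<^sub>R F"
  \<comment> \<open>Bounded operators are only real-linear here. Commuting with complex scalars is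
    what allows the fixed point to be turned back into a complex matrix, and symmetry makes that
    matrix Hermitian; both conditions are closed and stable under the iteration.\<close>
  define E where "E = {X :: (complex^'n) \<Rightarrow>\<^sub>L (complex^'n).
     (\<forall>x y. X x \<bullet> y = x \<bullet> X y) \<and> (\<forall>s x. X (s *s x) = s *s X x)}"
  have "closed E"
  proof -
    have cont: "continuous_on UNIV (\<lambda>X :: (complex^'n) \<Rightarrow>\<^sub>L (complex^'n). X x)" for x
      by (intro continuous_intros)
    have "continuous_on UNIV (\<lambda>X :: (complex^'n) \<Rightarrow>\<^sub>L (complex^'n). s *s X x)" for s x
      unfolding vector_scalar_mult_def by (intro continuous_intros)
    then show ?thesis
      unfolding E_def
      by (intro closed_Collect_conj closed_Collect_all closed_Collect_eq continuous_intros) auto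
  qed
  have "?B \<in> E"
    using A by (auto simp: E_def F blinfun.bilinear_simps inner_diff_left inner_diff_right
        psd_iff_inner matrix_vector_mult_vector_scalar vec_eq_iff algebra_simps)
  have add: "X + Y \<in> E" "a *\<^sub>R X \<in> E" "X o\<^sub>L X \<in> E" if "X \<in> E" "Y \<in> E" for X Y a
  proof -
    show "X + Y \<in> E" using that
      by (simp add: E_def blinfun.bilinear_simps inner_add_left inner_add_right vector_add_ldistrib)
    show "a *\<^sub>R X \<in> E" using that(1)
      by (simp add: E_def blinfun.bilinear_simps) (simp add: vec_eq_iff)
    show "X o\<^sub>L X \<in> E" using that(1) by (simp add: E_def)
  qed
  have "0 \<in> E" by (auto simp: E_def)
  obtain X where X: "X \<in> E" "norm X \<le> q" "(1/2) *\<^sub>R (?B + (X o\<^sub>L X)) = X"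
    using contraction_fixed_point[OF q \<open>closed E\<close> \<open>0 \<in> E\<close> \<open>?B \<in> E\<close>] add by metis
  define T where "T x = sqrt c *\<^sub>R (x - X x)" for x
  have "Vector_Spaces.linear (*s) (*s) T"
    using X(1) by unfold_locales
     (auto simp: E_def T_def vec_eq_iff algebra_simps blinfun.bilinear_simps)
  then have T: "matrix T *v x = T x" for x by (rule matrix_works)
  have "x \<bullet> X x \<le> norm x * norm x" for x
  proof -
    have "x \<bullet> X x \<le> norm x * norm (X x)" by (rule norm_cauchy_schwarz)
    also have "norm (X x) \<le> 1 * norm x"
      using X(2) q(2) by (meson norm_blinfun mult_right_mono norm_ge_zero order_trans less_imp_le)
    finally show ?thesis by (simp add: mult_left_mono)
  qed
  then have "psd (matrix T)"
    using X(1) c by (auto simp: psd_iff_inner T T_def E_def inner_diff_left inner_diff_right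
        power2_norm_eq_inner[symmetric] power2_eq_square)
  moreover have "T (T x) = A *v x" for x
  proof -
    \<comment> \<open>The fixed point equation is unfolded into
      \<open>1 - 2 X + X\<^sup>2 = A / c\<close>, read pointwise.\<close>
    have "2 *\<^sub>R X = ?B + (X o\<^sub>L X)" by (subst (1) X(3)[symmetric]) simp
    then have "(2 *\<^sub>R X) x = (?B + (X o\<^sub>L X)) x" by simp
    then have "2 *\<^sub>R X x = x - (1 / c) *\<^sub>R (A *v x) + X (X x)"
      by (simp add: blinfun.bilinear_simps F)
    then have "x - 2 *\<^sub>R X x + X (X x) = (1 / c) *\<^sub>R (A *v x)" by (simp add: algebra_simps)
    then have "c *\<^sub>R (x - 2 *\<^sub>R X x + X (X x)) = A *v x" using c by simp
    moreover have "T (T x) = c *\<^sub>R (x - 2 *\<^sub>R X x + X (X x))"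
      using c by (simp add: T_def blinfun.bilinear_simps scaleR_diff_right[symmetric] scaleR_2 diff_diff_eq)
    ultimately show ?thesis by simp
  qed
  then have "matrix T ** matrix T = A"
    by (simp add: matrix_eq matrix_vector_mul_assoc[symmetric] T)
  ultimately show ?thesis by blast
qed

text \<open>For Hermitian \<open>S\<close> the product of the entries at (i, j) and (j, i) is the
  squared modulus of either, so the trace of the square is the squared Frobenius norm, which is the
  norm of nested vectors. It bounds a root by the trace of the matrix it came from.\<close>

lemma norm_psd_sqrt:
  fixes S :: "complex^'n^'n"
  assumes "psd S"
  shows "(norm S)\<^sup>2 = Re (trace (S ** S))"
proof -
  have h: "S $ j $ i = cnj (S $ i $ j)" for i j
    using assms by (simp add: psd_def ctranspose_def vec_eq_iff)
  have "S $ i $ j * S $ j $ i = of_real ((norm (S $ i $ j))\<^sup>2)" for i j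
    using complex_norm_square[of "S $ i $ j"] h[of j i] by metis
  then have "Re (trace (S ** S)) = (\<Sum>i\<in>UNIV. \<Sum>j\<in>UNIV. (norm (S $ i $ j))\<^sup>2)"
    by (simp add: trace_def matrix_matrix_mult_def)
  then show ?thesis
    by (simp add: power2_norm_eq_inner inner_vec_def[of S S] inner_vec_def[of "S $ i" "S $ i" for i])
qed

lemma continuous_on_matrix_mult [continuous_intros]:
  fixes f :: "'x::topological_space \<Rightarrow> complex^'n^'m"
  assumes "continuous_on s f" "continuous_on s g"
  shows "continuous_on s (\<lambda>x. f x ** g x)"
  unfolding matrix_matrix_mult_def by (intro continuous_intros assms)

lemma continuous_on_matrix_vector_mult [continuous_intros]:
  fixes f :: "'x::topological_space \<Rightarrow> complex^'n^'m"
  assumes "continuous_on s f" "continuous_on s g"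
  shows "continuous_on s (\<lambda>x. f x *v g x)"
  unfolding matrix_vector_mult_def by (intro continuous_intros assms)

lemma closed_psd: "closed {A :: complex^'n^'n. psd A}"
  unfolding psd_iff_inner
  by (intro closed_Collect_conj closed_Collect_all closed_Collect_eq closed_Collect_le continuous_intros)

text \<open>A semidefinite matrix has no positive lower bound, so it is shifted by a small multiple
  of the identity. The roots of the shifted matrices are bounded through their traces, hence
  subconverge; closedness of \<open>psd\<close> and continuity of squaring identify the limit as a
  root of \<open>A\<close>.\<close>

lemma psd_sqrt_exists:
  fixes A :: "complex^'n^'n"
  assumes A: "psd A"
  shows "\<exists>S. psd S \<and> S ** S = A"
proof -
  define \<epsilon> where "\<epsilon> n = inverse (real (Suc n))" for n
  have \<epsilon>: "0 < \<epsilon> n" "\<epsilon> n \<le> 1" for n by (auto simp: \<epsilon>_def field_simps)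
  have \<epsilon>_lim: "\<epsilon> \<longlonglongrightarrow> 0" unfolding \<epsilon>_def by (rule LIMSEQ_inverse_real_of_nat)
  let ?A = "\<lambda>n. A + \<epsilon> n *\<^sub>R mat 1 :: complex^'n^'n"
  have app: "?A n *v x = A *v x + \<epsilon> n *\<^sub>R x" for n x
    by (simp add: matrix_vector_mult_add_rdistrib scaleR_matrix_vector_mult)
  have "\<exists>S. psd S \<and> S ** S = ?A n" for n
  proof (rule psd_sqrt_exists_posdef[of _ "\<epsilon> n"])
    show "psd (?A n)" using A by (simp add: psd_iff_inner app inner_add_left inner_add_right less_imp_le[OF \<epsilon>(1)])
    show "\<epsilon> n * (norm x)\<^sup>2 \<le> x \<bullet> (?A n *v x)" for x
      using A by (simp add: app psd_iff_inner inner_add_right power2_norm_eq_inner)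
  qed (fact \<epsilon>)
  then obtain S where S: "\<And>n. psd (S n)" "\<And>n. S n ** S n = ?A n" by metis
  have "(norm (S n))\<^sup>2 \<le> Re (trace A) + real CARD('n)" for n
    using norm_psd_sqrt[OF S(1), of n] S(2)[of n] \<epsilon>(2)[of n]
    by (simp add: trace_def mat_def sum.distrib mult_left_le_one_le)
  then have "bounded (range S)"
    by (intro boundedI[of _ "sqrt (Re (trace A) + real CARD('n))"]) (auto simp: real_le_rsqrt)
  then obtain T f where f: "strict_mono (f :: nat \<Rightarrow> nat)" and lim: "(S \<circ> f) \<longlonglongrightarrow> T"
    using bounded_imp_convergent_subsequence by blast
  have "psd T"
    using closed_sequentially[OF closed_psd _ lim] S(1) by auto
  have "continuous_on UNIV (\<lambda>S::complex^'n^'n. S ** S)" by (intro continuous_intros)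
  from continuous_on_tendsto_compose[OF this lim] have "(\<lambda>n. A + \<epsilon> (f n) *\<^sub>R mat 1) \<longlonglongrightarrow> T ** T"
    by (simp add: S(2))
  moreover have "(\<lambda>n. A + \<epsilon> (f n) *\<^sub>R mat 1) \<longlonglongrightarrow> A + 0 *\<^sub>R mat 1"
    using LIMSEQ_subseq_LIMSEQ[OF \<epsilon>_lim f] by (intro tendsto_intros) (simp add: o_def)
  ultimately have "T ** T = A + 0 *\<^sub>R mat 1" by (rule LIMSEQ_unique)
  then have "T ** T = A" by simp
  with \<open>psd T\<close> show ?thesis by blast
qed

lemma psd_sqrt:
  assumes "psd A"
  shows "psd (psd_sqrt A)" "psd_sqrt A ** psd_sqrt A = A"
  using someI_ex[OF psd_sqrt_exists[OF assms]] by (auto simp: psd_sqrt_def)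

section \<open>Matrix algebra for second moments\<close>

lemma ctranspose_matrix_mult: "ctranspose (A ** B) = ctranspose B ** ctranspose A"
  by (simp add: vec_eq_iff ctranspose_def matrix_matrix_mult_def mult.commute)

lemma ctranspose_scaleR: "ctranspose (a *\<^sub>R A) = a *\<^sub>R ctranspose A"
  by (simp add: vec_eq_iff ctranspose_def)

lemma matrix_vector_mult_scaleR_right: "A *v (a *\<^sub>R x) = a *\<^sub>R (A *v x)" for A :: "complex^'n^'m"
  by (simp add: vec_eq_iff matrix_vector_mult_def scaleR_sum_right)

lemma matrix_mult_scaleR:
  fixes A :: "complex^'n^'m" and B :: "complex^'p^'n"
  shows "(a *\<^sub>R A) ** B = a *\<^sub>R (A ** B)" "A ** (a *\<^sub>R B) = a *\<^sub>R (A ** B)"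
  by (simp_all add: vec_eq_iff matrix_matrix_mult_def scaleR_sum_right)

lemma matrix_mult_cscale_mat_1: "A ** cscale z (mat 1) = cscale z A"
  by (simp add: vec_eq_iff matrix_matrix_mult_def cscale_def mat_def if_distrib mult.commute cong: if_cong)

lemma cscale_matrix_mult: "cscale z A ** B = cscale z (A ** B)"
  by (simp add: vec_eq_iff matrix_matrix_mult_def cscale_def sum_distrib_left mult.assoc)

lemma cscale_scaleR: "cscale z (a *\<^sub>R A) = cscale (complex_of_real a * z) A"
  by (simp add: vec_eq_iff cscale_def scaleR_conv_of_real[where 'a = complex] mult_ac)

lemma trace_scaleR: "trace (a *\<^sub>R A) = complex_of_real a * trace A" for A :: "complex^'n^'n"
  by (simp add: trace_def scaleR_conv_of_real[where 'a = complex] sum_distrib_left)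

lemma outer_vector_mult: "outer a b *v x = cinner b x *s a"
  by (simp add: vec_eq_iff outer_def matrix_vector_mult_def cinner_def sum_distrib_left sum_distrib_right mult_ac)

lemma sum_matrix_vector_mult: "(\<Sum>i\<in>I. A i) *v x = (\<Sum>i\<in>I. A i *v x)" for A :: "'i \<Rightarrow> complex^'n^'m"
  by (induction I rule: infinite_finite_induct) (simp_all add: matrix_vector_mult_add_rdistrib)

section \<open>Moments of the standard complex normal distribution\<close>

text \<open>With variance 1/2 each coordinate has density
  \<open>exp (- x\<^sup>2) / sqrt pi\<close>, so the two exponents add up to the squared modulus and
  the two constants multiply to \<open>1 / pi\<close>.\<close>

lemma std_complex_normal_density_eq:
  "exp (- (cmod z)\<^sup>2) / pi = normal_density 0 (1 / sqrt 2) (Re z) * normal_density 0 (1 / sqrt 2) (Im z)"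
proof -
  have "sqrt pi * sqrt pi = pi" by simp
  then show ?thesis
    by (simp add: normal_density_def cmod_power2 power_divide mult_exp_exp)
qed

text \<open>Lebesgue measure on the complex plane is a product over the basis consisting of 1 and
  the imaginary unit, so an integrand of product form factorises. The total mass and the second
  moment are the instances with 1 and the square as factors.\<close>

lemma nn_integral_std_complex_normal:
  fixes f g :: "real \<Rightarrow> real"
  assumes [measurable]: "f \<in> borel_measurable borel" "g \<in> borel_measurable borel"
    and nn: "\<And>x. 0 \<le> f x" "\<And>x. 0 \<le> g x"
  shows "(\<integral>\<^sup>+z. ennreal (f (Re z) * g (Im z)) \<partial>std_complex_normal)
    = (\<integral>\<^sup>+x. ennreal (normal_density 0 (1 / sqrt 2) x * f x) \<partial>lborel)
    * (\<integral>\<^sup>+x. ennreal (normal_density 0 (1 / sqrt 2) x * g x) \<partial>lborel)"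
proof -
  let ?n = "normal_density 0 (1 / sqrt 2)"
  let ?F = "\<lambda>b x. if b = (1::complex) then ennreal (?n x * f x) else ennreal (?n x * g x)"
  have "(\<integral>\<^sup>+z. ennreal (f (Re z) * g (Im z)) \<partial>std_complex_normal)
      = (\<integral>\<^sup>+z. (\<Prod>b\<in>Basis. ?F b (z \<bullet> b)) \<partial>lborel)"
    unfolding std_complex_normal_def std_complex_normal_density_eq
    using nn
    by (subst nn_integral_density)
       (auto simp: Basis_complex_def ennreal_mult[symmetric] mult_ac intro!: nn_integral_cong)
  also have "\<dots> = (\<Prod>b\<in>Basis. \<integral>\<^sup>+x. ?F b x \<partial>lborel)"
    by (rule nn_integral_lborel_prod) auto
  finally show ?thesis by (simp add: Basis_complex_def)
qed

lemma nn_integral_normal_density_half: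
  "(\<integral>\<^sup>+x. ennreal (normal_density 0 (1 / sqrt 2) x) \<partial>lborel) = 1"
  "(\<integral>\<^sup>+x. ennreal (normal_density 0 (1 / sqrt 2) x * x\<^sup>2) \<partial>lborel) = ennreal (1/2)"
proof -
  let ?n = "normal_density 0 (1 / sqrt 2)"
  have "has_bochner_integral lborel ?n 1"
    using normal_moment_even[of "1 / sqrt 2" 0 0] by simp
  then show "(\<integral>\<^sup>+x. ennreal (?n x) \<partial>lborel) = 1"
    by (simp add: has_bochner_integral_iff nn_integral_eq_integral)
  have "has_bochner_integral lborel (\<lambda>x. ?n x * x\<^sup>2) (1/2)"
    using normal_moment_even[of "1 / sqrt 2" 0 1] by (simp add: power_divide)
  then have *: "integrable lborel (\<lambda>x. ?n x * x\<^sup>2)" "(\<integral>x. ?n x * x\<^sup>2 \<partial>lborel) = 1/2"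
    unfolding has_bochner_integral_iff by auto
  from *(1) have "(\<integral>\<^sup>+x. ennreal (?n x * x\<^sup>2) \<partial>lborel) = ennreal (\<integral>x. ?n x * x\<^sup>2 \<partial>lborel)"
    by (rule nn_integral_eq_integral) auto
  then show "(\<integral>\<^sup>+x. ennreal (?n x * x\<^sup>2) \<partial>lborel) = ennreal (1/2)"
    by (simp only: *(2))
qed

lemma prob_space_std_complex_normal: "prob_space std_complex_normal"
proof
  have "(\<integral>\<^sup>+z. 1 \<partial>std_complex_normal) = 1"
    using nn_integral_std_complex_normal[of "\<lambda>_. 1" "\<lambda>_. 1"]
    by (simp add: nn_integral_normal_density_half)
  then show "emeasure std_complex_normal (space std_complex_normal) = 1" by simp
qed

lemma sets_std_complex_normal [measurable_cong, simp]: "sets std_complex_normal = sets borel"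
  by (simp add: std_complex_normal_def)

text \<open>The real and the imaginary part contribute 1/2 each. Computing in \<open>ennreal\<close>
  yields integrability and value in one go.\<close>

lemma std_complex_normal_second_moment:
  "integrable std_complex_normal (\<lambda>z. (cmod z)\<^sup>2)"
  "(\<integral>z. (cmod z)\<^sup>2 \<partial>std_complex_normal) = 1"
proof -
  have "(\<integral>\<^sup>+z. ennreal ((cmod z)\<^sup>2) \<partial>std_complex_normal)
      = (\<integral>\<^sup>+z. ennreal ((Re z)\<^sup>2 * 1) + ennreal (1 * (Im z)\<^sup>2) \<partial>std_complex_normal)"
    by (intro nn_integral_cong) (simp add: cmod_power2 ennreal_plus[symmetric] del: ennreal_plus)
  also have "\<dots> = (\<integral>\<^sup>+z. ennreal ((Re z)\<^sup>2 * 1) \<partial>std_complex_normal)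
      + (\<integral>\<^sup>+z. ennreal (1 * (Im z)\<^sup>2) \<partial>std_complex_normal)"
    by (rule nn_integral_add) auto
  also have "\<dots> = ennreal (1/2) * 1 + 1 * ennreal (1/2)"
    using nn_integral_std_complex_normal[of "\<lambda>x. x\<^sup>2" "\<lambda>_. 1"]
      nn_integral_std_complex_normal[of "\<lambda>_. 1" "\<lambda>x. x\<^sup>2"]
    by (simp add: nn_integral_normal_density_half)
  also have "\<dots> = ennreal (1/2 + 1/2)" by (subst ennreal_plus) auto
  also have "\<dots> = ennreal 1" by simp
  finally have *: "(\<integral>\<^sup>+z. ennreal ((cmod z)\<^sup>2) \<partial>std_complex_normal) = ennreal 1" .
  show "integrable std_complex_normal (\<lambda>z. (cmod z)\<^sup>2)"
    by (rule integrableI_nn_integral_finite[OF _ _ *]) auto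
  show "(\<integral>z. (cmod z)\<^sup>2 \<partial>std_complex_normal) = 1"
    by (subst integral_eq_nn_integral) (auto simp: *)
qed

text \<open>The density is even and Lebesgue measure is invariant under negation, so the integral
  equals its own negative.\<close>

lemma std_complex_normal_mean: "(\<integral>z. z \<partial>std_complex_normal) = 0"
proof -
  let ?h = "\<lambda>z::complex. (exp (- (cmod z)\<^sup>2) / pi) *\<^sub>R z"
  have "lborel = distr lborel borel (\<lambda>z::complex. - z)"
    using lborel_affine[of "-1::real" "0::complex"] by (simp add: density_1)
  then have "integral\<^sup>L lborel ?h = integral\<^sup>L (distr lborel borel (\<lambda>z::complex. - z)) ?h" by simp
  also have "\<dots> = - integral\<^sup>L lborel ?h" by (subst integral_distr) auto
  finally have "integral\<^sup>L lborel ?h = 0" by simp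
  then show ?thesis
    unfolding std_complex_normal_def by (subst integral_density) auto
qed

section \<open>Square integrable functions and second moment matrices\<close>

text \<open>Membership in L2 as a predicate on functions with values in any normed space, so that
  scalars, vectors and matrices are treated alike.\<close>

definition square_integrable :: "'a measure \<Rightarrow> ('a \<Rightarrow> 'b::{second_countable_topology, real_normed_vector}) \<Rightarrow> bool" where
  "square_integrable M f \<longleftrightarrow> f \<in> borel_measurable M \<and> integrable M (\<lambda>x. (norm (f x))\<^sup>2)"

lemma square_integrable_measurable: "square_integrable M f \<Longrightarrow> f \<in> borel_measurable M"
  by (simp add: square_integrable_def)

lemma square_integrable_add:
  assumes f: "square_integrable M f" and g: "square_integrable M g"
  shows "square_integrable M (\<lambda>x. f x + g x)"
proof -
  note [measurable] = f[THEN square_integrable_measurable] g[THEN square_integrable_measurable]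
  have *: "norm ((norm (f x + g x))\<^sup>2) \<le> norm (2 * (norm (f x))\<^sup>2 + 2 * (norm (g x))\<^sup>2)" for x
  proof -
    have "(norm (f x + g x))\<^sup>2 \<le> (norm (f x) + norm (g x))\<^sup>2"
      by (simp add: norm_triangle_ineq power_mono)
    also have "\<dots> \<le> 2 * (norm (f x))\<^sup>2 + 2 * (norm (g x))\<^sup>2"
      using sum_squares_bound[of "norm (f x)" "norm (g x)"] by (simp add: power2_sum)
    finally show ?thesis by simp
  qed
  have "integrable M (\<lambda>x. (norm (f x + g x))\<^sup>2)"
  proof (rule Bochner_Integration.integrable_bound[OF _ _ AE_I2[OF *]])
    show "integrable M (\<lambda>x. 2 * (norm (f x))\<^sup>2 + 2 * (norm (g x))\<^sup>2)"
      using f g by (simp add: square_integrable_def)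
  qed simp
  then show ?thesis by (simp add: square_integrable_def)
qed

lemma square_integrable_zero: "square_integrable M (\<lambda>x. 0)"
  by (simp add: square_integrable_def)

lemma square_integrable_sum:
  assumes "\<And>i. i \<in> I \<Longrightarrow> square_integrable M (f i)"
  shows "square_integrable M (\<lambda>x. \<Sum>i\<in>I. f i x)"
  using assms
  by (induction I rule: infinite_finite_induct)
     (auto intro: square_integrable_add square_integrable_zero)

lemma square_integrable_bounded_linear:
  assumes T: "bounded_linear T" and f: "square_integrable M f"
  shows "square_integrable M (\<lambda>x. T (f x))"
proof -
  note [measurable] = f[THEN square_integrable_measurable]
  have [measurable]: "T \<in> borel_measurable borel"
    by (intro borel_measurable_continuous_onI linear_continuous_on T)
  obtain K where K: "\<And>x. norm (T x) \<le> norm x * K"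
    using bounded_linear.bounded[OF T] by blast
  have *: "norm ((norm (T (f x)))\<^sup>2) \<le> norm (K\<^sup>2 * (norm (f x))\<^sup>2)" for x
    using power_mono[OF K[of "f x"], of 2] by (simp add: power_mult_distrib mult.commute)
  have "integrable M (\<lambda>x. (norm (T (f x)))\<^sup>2)"
  proof (rule Bochner_Integration.integrable_bound[OF _ _ AE_I2[OF *]])
    show "integrable M (\<lambda>x. K\<^sup>2 * (norm (f x))\<^sup>2)"
      using f by (simp add: square_integrable_def)
  qed simp
  then show ?thesis by (simp add: square_integrable_def)
qed

text \<open>The product of two norms is dominated by the sum of their squares. The statement is for
  general bilinear maps because it is applied to scaling, complex multiplication, the inner product
  and \<open>outer\<close>.\<close>

lemma square_integrable_bilinear:
  fixes f :: "'a \<Rightarrow> 'b::{second_countable_topology, real_normed_vector}"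
    and g :: "'a \<Rightarrow> 'c::{second_countable_topology, real_normed_vector}"
    and T :: "'b \<Rightarrow> 'c \<Rightarrow> 'd::{second_countable_topology, banach}"
  assumes T: "bounded_bilinear T" and f: "square_integrable M f" and g: "square_integrable M g"
  shows "integrable M (\<lambda>x. T (f x) (g x))"
proof -
  interpret bounded_bilinear T by fact
  note [measurable] = f[THEN square_integrable_measurable] g[THEN square_integrable_measurable]
  have "(\<lambda>(x, y). T x y) \<in> borel_measurable (borel \<Otimes>\<^sub>M borel)"
    unfolding borel_prod
    by (intro borel_measurable_continuous_onI) (auto simp: split_beta intro!: continuous_intros continuous_on)
  then have [measurable]: "(\<lambda>x. T (f x) (g x)) \<in> borel_measurable M"
    using measurable_compose[of "\<lambda>x. (f x, g x)" M "borel \<Otimes>\<^sub>M borel" "\<lambda>(x, y). T x y" borel]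
    by auto
  obtain K where K: "0 \<le> K" "\<And>x y. norm (T x y) \<le> norm x * norm y * K"
    using nonneg_bounded by blast
  have *: "norm (T (f x) (g x)) \<le> norm (K * (norm (f x))\<^sup>2 + K * (norm (g x))\<^sup>2)" for x
  proof -
    have "norm (f x) * norm (g x) \<le> (norm (f x))\<^sup>2 + (norm (g x))\<^sup>2"
    proof -
      have "2 * (norm (f x) * norm (g x)) \<le> (norm (f x))\<^sup>2 + (norm (g x))\<^sup>2"
        using sum_squares_bound[of "norm (f x)" "norm (g x)"] by (simp only: mult.assoc)
      moreover have "0 \<le> norm (f x) * norm (g x)" by simp
      ultimately show ?thesis by linarith
    qed
    then have "norm (f x) * norm (g x) * K \<le> ((norm (f x))\<^sup>2 + (norm (g x))\<^sup>2) * K"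
      using K(1) by (rule mult_right_mono)
    from order_trans[OF K(2) this] have "norm (T (f x) (g x)) \<le> K * (norm (f x))\<^sup>2 + K * (norm (g x))\<^sup>2"
      by (simp only: distrib_right mult.commute[of K])
    then show ?thesis unfolding real_norm_def by (rule order_trans[OF _ abs_ge_self])
  qed
  show ?thesis
  proof (rule Bochner_Integration.integrable_bound[OF _ _ AE_I2[OF *]])
    show "integrable M (\<lambda>x. K * (norm (f x))\<^sup>2 + K * (norm (g x))\<^sup>2)"
      using f g by (simp add: square_integrable_def)
  qed simp
qed

lemma (in finite_measure) square_integrable_const: "square_integrable M (\<lambda>x. a)"
  by (simp add: square_integrable_def)

lemma (in finite_measure) square_integrable_integrable:
  fixes f :: "'a \<Rightarrow> 'b::{second_countable_topology, banach}"
  assumes "square_integrable M f"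
  shows "integrable M f"
  using square_integrable_bilinear[OF bounded_bilinear_scaleR square_integrable_const[of "1::real"] assms]
  by simp

lemma borel_measurable_vec:
  fixes f :: "'a \<Rightarrow> 'b::euclidean_space^'n"
  assumes "\<And>i. (\<lambda>x. f x $ i) \<in> borel_measurable M"
  shows "f \<in> borel_measurable M"
proof -
  have "(\<lambda>x. f x \<bullet> b) \<in> borel_measurable M" if "b \<in> Basis" for b
    using that assms by (auto simp: Basis_vec_def inner_axis)
  then show ?thesis by (simp add: borel_measurable_euclidean_space[of f])
qed

lemma square_integrable_vec:
  fixes f :: "'a \<Rightarrow> 'b::euclidean_space^'n"
  assumes "\<And>i. square_integrable M (\<lambda>x. f x $ i)"
  shows "square_integrable M f"
proof -
  have "f \<in> borel_measurable M"
    using assms by (intro borel_measurable_vec square_integrable_measurable)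
  moreover have "(norm (f x))\<^sup>2 = (\<Sum>i\<in>UNIV. (norm (f x $ i))\<^sup>2)" for x
    by (simp add: power2_norm_eq_inner inner_vec_def)
  ultimately show ?thesis using assms by (simp add: square_integrable_def)
qed

section \<open>Rank-one matrices and their expectations\<close>

lemma norm_outer: "norm (outer u v) = norm u * norm v"
proof -
  have "norm (outer u v $ i) = norm (u $ i) * norm v" for i
    by (simp add: outer_def norm_vec_def[of v] norm_vec_def[of "vec_lambda _"] norm_mult L2_set_right_distrib)
  then show ?thesis
    by (simp add: norm_vec_def[of "outer u v"] norm_vec_def[of u] L2_set_left_distrib)
qed

lemma bounded_bilinear_outer: "bounded_bilinear outer"
proof
  show "\<exists>K. \<forall>a b. norm (outer a b) \<le> norm a * norm b * K"
    by (rule exI[of _ 1]) (simp add: norm_outer)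
qed (simp_all add: outer_def vec_eq_iff algebra_simps)

lemma outer_matrix_vector_mult: "outer (A *v u) (B *v v) = A ** outer u v ** ctranspose B"
  by (simp add: vec_eq_iff outer_def matrix_vector_mult_def matrix_matrix_mult_def ctranspose_def
      sum_product sum_distrib_left sum_distrib_right mult_ac)

lemma inner_eq_trace_outer: "x \<bullet> y = Re (trace (outer x y))"
  by (simp add: inner_vec_def trace_def outer_def inner_complex_def)

lemma bounded_linear_matrix_sandwich:
  "bounded_linear (\<lambda>X :: complex^'n^'m. A ** X ** B)"
proof -
  have "linear (\<lambda>X :: complex^'n^'m. A ** X ** B)"
    by (rule linearI) (simp_all add: vec_eq_iff matrix_matrix_mult_def sum.distrib algebra_simps scaleR_sum_right sum_distrib_left)
  then show ?thesis by (simp add: linear_conv_bounded_linear)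
qed

lemma bounded_linear_trace: "bounded_linear (trace :: complex^'n^'n \<Rightarrow> complex)"
proof -
  have "linear (trace :: complex^'n^'n \<Rightarrow> complex)"
    by (rule linearI) (simp_all add: trace_def sum.distrib scaleR_sum_right)
  then show ?thesis by (simp add: linear_conv_bounded_linear)
qed

lemma integrable_outer:
  assumes "square_integrable M u" "square_integrable M v"
  shows "integrable M (\<lambda>\<omega>. outer (u \<omega>) (v \<omega>))"
  using square_integrable_bilinear[OF bounded_bilinear_outer assms] .

lemma square_integrable_nth: "square_integrable M u \<Longrightarrow> square_integrable M (\<lambda>\<omega>. u \<omega> $ i)"
  by (rule square_integrable_bounded_linear[OF bounded_linear_vec_nth])

lemma square_integrable_matrix_vector_mult:
  fixes A :: "complex^'n^'m"
  shows "square_integrable M u \<Longrightarrow> square_integrable M (\<lambda>\<omega>. A *v u \<omega>)"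
  by (rule square_integrable_bounded_linear[OF matrix_vector_mul_bounded_linear])

lemma integral_nth:
  fixes f :: "'a \<Rightarrow> 'b::euclidean_space^'n"
  shows "integrable M f \<Longrightarrow> (\<integral>\<omega>. f \<omega> \<partial>M) $ i = (\<integral>\<omega>. f \<omega> $ i \<partial>M)"
  by (rule integral_bounded_linear[symmetric, OF bounded_linear_vec_nth])

lemma integral_outer_nth:
  assumes "square_integrable M u" "square_integrable M v"
  shows "(\<integral>\<omega>. outer (u \<omega>) (v \<omega>) \<partial>M) $ i $ j = (\<integral>\<omega>. u \<omega> $ i * cnj (v \<omega> $ j) \<partial>M)"
proof -
  have "integrable M (\<lambda>\<omega>. outer (u \<omega>) (v \<omega>) $ i)"
    using integrable_bounded_linear[OF bounded_linear_vec_nth integrable_outer[OF assms]] .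
  then show ?thesis
    by (simp add: integral_nth integrable_outer[OF assms]) (simp add: outer_def)
qed

lemma integral_outer_matrix_vector_mult:
  assumes "square_integrable M u" "square_integrable M v"
  shows "(\<integral>\<omega>. outer (A *v u \<omega>) (B *v v \<omega>) \<partial>M) = A ** (\<integral>\<omega>. outer (u \<omega>) (v \<omega>) \<partial>M) ** ctranspose B"
  unfolding outer_matrix_vector_mult
  by (rule integral_bounded_linear[OF bounded_linear_matrix_sandwich integrable_outer[OF assms]])

lemma ctranspose_mat_1 [simp]: "ctranspose (mat 1) = mat 1"
  by (simp add: ctranspose_def mat_def vec_eq_iff)

lemma integral_outer_matrix_vector_mult_left:
  assumes "square_integrable M u" "square_integrable M v"
  shows "(\<integral>\<omega>. outer (A *v u \<omega>) (v \<omega>) \<partial>M) = A ** (\<integral>\<omega>. outer (u \<omega>) (v \<omega>) \<partial>M)"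
  using integral_outer_matrix_vector_mult[OF assms, of A "mat 1"] by simp

lemma integral_inner_eq_trace:
  assumes "square_integrable M u" "square_integrable M v"
  shows "(\<integral>\<omega>. u \<omega> \<bullet> v \<omega> \<partial>M) = Re (trace (\<integral>\<omega>. outer (u \<omega>) (v \<omega>) \<partial>M))"
  unfolding inner_eq_trace_outer
  by (rule integral_bounded_linear[OF bounded_linear_compose[OF bounded_linear_Re bounded_linear_trace]
        integrable_outer[OF assms]])

text \<open>Evaluating a matrix in its quadratic form is a bounded linear functional and passes
  through the integral. What remains is the expectation of
  \<open>Re (cinner x (u \<omega>) * cinner (u \<omega>) y)\<close>, which is symmetric in
  \<open>x\<close> and \<open>y\<close> and for \<open>x = y\<close> integrates a squared
  modulus.\<close>

lemma psd_integral_outer: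
  fixes u :: "'a \<Rightarrow> complex^'b"
  assumes u: "square_integrable M u"
  shows "psd (\<integral>\<omega>. outer (u \<omega>) (u \<omega>) \<partial>M)"
proof -
  let ?R = "\<integral>\<omega>. outer (u \<omega>) (u \<omega>) \<partial>M"
  have blin: "bounded_linear (\<lambda>X :: complex^'b^'b. (X *v x) \<bullet> y)" for x y
  proof -
    have "linear (\<lambda>X :: complex^'b^'b. (X *v x) \<bullet> y)"
      by (rule linearI)
         (simp_all add: matrix_vector_mult_add_rdistrib scaleR_matrix_vector_mult inner_add_left)
    then show ?thesis by (simp add: linear_conv_bounded_linear)
  qed
  have app: "outer a b *v x = cinner b x *s a" for a b x :: "complex^'b"
    by (simp add: vec_eq_iff outer_def matrix_vector_mult_def cinner_def sum_distrib_left sum_distrib_right mult_ac)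
  have cinner_scale: "cinner (s *s a) y = cnj s * cinner a y" for s and a y :: "complex^'b"
    by (simp add: cinner_def sum_distrib_left mult_ac)
  have cnj_cinner: "cnj (cinner a x) = cinner x a" for a x :: "complex^'b"
    by (simp add: cinner_def mult_ac)
  have R: "(?R *v x) \<bullet> y = (\<integral>\<omega>. Re (cinner x (u \<omega>) * cinner (u \<omega>) y) \<partial>M)" for x y
  proof -
    have "(?R *v x) \<bullet> y = (\<integral>\<omega>. (outer (u \<omega>) (u \<omega>) *v x) \<bullet> y \<partial>M)"
      by (rule integral_bounded_linear[symmetric, OF blin integrable_outer[OF u u]])
    then show ?thesis
      by (simp add: app inner_eq_Re_cinner cinner_scale cnj_cinner)
  qed
  have "(?R *v x) \<bullet> y = x \<bullet> (?R *v y)" for x y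
  proof -
    have "Re (cinner x a * cinner a y) = Re (cinner y a * cinner a x)" for a :: "complex^'b"
      by (simp add: cnj_cinner[of a y, symmetric] cnj_cinner[of x a, symmetric] mult.commute)
    then show ?thesis by (simp add: R inner_commute[of x])
  qed
  moreover have "0 \<le> (?R *v x) \<bullet> x" for x
  proof -
    have "0 \<le> Re (cinner x a * cinner a x)" for a
      unfolding cnj_cinner[of a x, symmetric] by (simp add: complex_mult_cnj mult.commute[of "cnj _"])
    then show ?thesis by (simp add: R)
  qed
  ultimately show ?thesis by (simp add: psd_iff_inner inner_commute)
qed

section \<open>The orthogonality principle for linear estimation\<close>

lemma invertible_psd_add_pos:
  fixes A :: "complex^'n^'n"
  assumes "psd A" "s > 0"
  shows "invertible (A + s *\<^sub>R mat 1)"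
proof -
  have "x = 0" if "(A + s *\<^sub>R mat 1) *v x = 0" for x
  proof -
    \<comment> \<open>The quadratic form of the shifted matrix is at least
      \<open>s * (x \<bullet> x)\<close>, so its kernel is trivial; for a square matrix this is
      invertibility.\<close>
    have "x \<bullet> (A *v x) + s * (x \<bullet> x) = x \<bullet> ((A + s *\<^sub>R mat 1) *v x)"
      by (simp add: matrix_vector_mult_add_rdistrib scaleR_matrix_vector_mult inner_add_right)
    with that have "x \<bullet> (A *v x) + s * (x \<bullet> x) = 0" by simp
    moreover have "0 \<le> x \<bullet> (A *v x)" using assms by (simp add: psd_iff_inner)
    ultimately have "s * (x \<bullet> x) \<le> 0" by linarith
    then have "x \<bullet> x \<le> 0" using \<open>s > 0\<close> by (simp add: mult_le_0_iff)
    then show "x = 0" using inner_ge_zero[of x] inner_eq_zero_iff[of x] by linarith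
  qed
  then show ?thesis
    using matrix_left_invertible_ker invertible_left_inverse by blast
qed

text \<open>The error of the candidate \<open>B C\<^sup>-\<^sup>1 r\<close> is uncorrelated with \<open>r\<close>, so the mean-square error splits by
  Pythagoras; invertibility of \<open>C\<close> makes the second summand vanish for no other matrix.\<close>

lemma is_lmmse_estimate_iff:
  fixes u :: "'a \<Rightarrow> complex^'m" and r :: "'a \<Rightarrow> complex^'n"
  assumes u: "square_integrable M u" and r: "square_integrable M r"
    and B: "(\<integral>\<omega>. outer (u \<omega>) (r \<omega>) \<partial>M) = B" and C: "(\<integral>\<omega>. outer (r \<omega>) (r \<omega>) \<partial>M) = C"
    and inv: "invertible C"
  shows "is_lmmse_estimate M u r v \<longleftrightarrow> v = (\<lambda>\<omega>. (B ** matrix_inv C) *v r \<omega>)"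
proof -
  define L where "L = B ** matrix_inv C"
  have "matrix_inv C ** C = mat 1" "C ** matrix_inv C = mat 1"
    using someI_ex[OF inv[unfolded invertible_def]] by (auto simp: matrix_inv_def)
  then have LC: "L ** C = B" by (simp add: L_def matrix_mul_assoc[symmetric])
  define e where "e \<omega> = u \<omega> - L *v r \<omega>" for \<omega>
  have Ar: "square_integrable M (\<lambda>\<omega>. A *v r \<omega>)" for A :: "complex^'n^'m"
    by (rule square_integrable_matrix_vector_mult[OF r])
  have e_alt: "e = (\<lambda>\<omega>. u \<omega> + (- L) *v r \<omega>)"
    by (simp add: e_def fun_eq_iff vec_eq_iff matrix_vector_mult_def sum_negf)
  have e: "square_integrable M e"
    unfolding e_alt by (rule square_integrable_add[OF u Ar])
  have er: "(\<integral>\<omega>. outer (e \<omega>) (r \<omega>) \<partial>M) = 0"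
  proof -
    have "(\<integral>\<omega>. outer (e \<omega>) (r \<omega>) \<partial>M) = (\<integral>\<omega>. outer (u \<omega>) (r \<omega>) - outer (L *v r \<omega>) (r \<omega>) \<partial>M)"
      by (simp add: e_def bounded_bilinear.diff_left[OF bounded_bilinear_outer])
    also have "\<dots> = B - L ** C"
      using integral_outer_matrix_vector_mult_left[OF r r, of L]
      by (simp add: integrable_outer u r Ar B C)
    finally show ?thesis by (simp add: LC)
  qed
  have mse: "mean_square_error M u r A = ennreal ((\<integral>\<omega>. (norm (e \<omega>))\<^sup>2 \<partial>M) + (\<integral>\<omega>. (norm ((L - A) *v r \<omega>))\<^sup>2 \<partial>M))"
    for A
  proof -
    let ?N = "L - A"
    have split: "(norm (u \<omega> - A *v r \<omega>))\<^sup>2 = (norm (e \<omega>))\<^sup>2 + (norm (?N *v r \<omega>))\<^sup>2 + 2 * (e \<omega> \<bullet> (?N *v r \<omega>))" for \<omega>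
    proof -
      have "u \<omega> - A *v r \<omega> = e \<omega> + ?N *v r \<omega>"
        by (simp add: e_def matrix_vector_mult_diff_rdistrib)
      then show ?thesis by (simp add: power2_norm_eq_inner inner_add_left inner_add_right inner_commute)
    qed
    have int: "integrable M (\<lambda>\<omega>. (norm (e \<omega>))\<^sup>2)" "integrable M (\<lambda>\<omega>. (norm (?N *v r \<omega>))\<^sup>2)"
      "integrable M (\<lambda>\<omega>. e \<omega> \<bullet> (?N *v r \<omega>))"
      using e Ar[of ?N] square_integrable_bilinear[OF bounded_bilinear_inner e Ar[of ?N]]
      by (auto simp: square_integrable_def)
    have "(\<integral>\<omega>. outer (e \<omega>) (?N *v r \<omega>) \<partial>M) = 0"
      using integral_outer_matrix_vector_mult[OF e r, of "mat 1" ?N] by (simp add: er)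
    then have "(\<integral>\<omega>. e \<omega> \<bullet> (?N *v r \<omega>) \<partial>M) = 0"
      by (simp add: integral_inner_eq_trace[OF e Ar] trace_def)
    then have "(\<integral>\<omega>. (norm (u \<omega> - A *v r \<omega>))\<^sup>2 \<partial>M) = (\<integral>\<omega>. (norm (e \<omega>))\<^sup>2 \<partial>M) + (\<integral>\<omega>. (norm (?N *v r \<omega>))\<^sup>2 \<partial>M)"
      by (simp add: split int)
    moreover have "integrable M (\<lambda>\<omega>. (norm (u \<omega> - A *v r \<omega>))\<^sup>2)"
      unfolding split using int by simp
    ultimately show ?thesis
      unfolding mean_square_error_def by (simp add: nn_integral_eq_integral)
  qed
  \<comment> \<open>The error of the candidate is a finite summand common to all matrices, so
    comparing mean-square errors amounts to comparing the real excess terms.\<close>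
  have mse_le: "mean_square_error M u r A \<le> mean_square_error M u r A' \<longleftrightarrow>
      (\<integral>\<omega>. (norm ((L - A) *v r \<omega>))\<^sup>2 \<partial>M) \<le> (\<integral>\<omega>. (norm ((L - A') *v r \<omega>))\<^sup>2 \<partial>M)" for A A'
    unfolding mse by (subst ennreal_le_iff) auto
  have L: "is_lmmse_matrix M u r L"
    by (simp add: is_lmmse_matrix_def mse_le)
  \<comment> \<open>Uniqueness is shown for the matrix itself, which makes the estimate unique as a
    function and not merely up to null sets.\<close>
  have uniq: "A = L" if "is_lmmse_matrix M u r A" for A
  proof -
    let ?N = "L - A"
    have "(\<integral>\<omega>. (norm (?N *v r \<omega>))\<^sup>2 \<partial>M) \<le> 0"
      using that[unfolded is_lmmse_matrix_def, rule_format, of L] by (simp add: mse_le)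
    then have "(\<integral>\<omega>. (norm (?N *v r \<omega>))\<^sup>2 \<partial>M) = 0"
      by (simp add: antisym)
    then have "AE \<omega> in M. (norm (?N *v r \<omega>))\<^sup>2 = 0"
      using Ar[of ?N] by (subst (asm) integral_nonneg_eq_0_iff_AE) (auto simp: square_integrable_def)
    then have ae: "AE \<omega> in M. ?N *v r \<omega> = 0" by simp
    \<comment> \<open>Vanishing of \<open>?N *v r \<omega>\<close> almost everywhere restricts
      \<open>?N\<close> only along the values of \<open>r\<close>. Multiplying by the conjugate
      transpose of \<open>r\<close> and integrating turns it into \<open>?N ** C = 0\<close>, where
      \<open>C\<close> can be cancelled.\<close>
    have "?N ** C = (\<integral>\<omega>. outer (?N *v r \<omega>) (r \<omega>) \<partial>M)"
      by (simp add: integral_outer_matrix_vector_mult_left[OF r r] C)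
    also have "\<dots> = 0"
      by (rule integral_eq_zero_AE) (use ae in \<open>auto simp: bounded_bilinear.zero_left[OF bounded_bilinear_outer]\<close>)
    finally have "?N ** C ** matrix_inv C = 0" by simp
    then have "?N = 0" using \<open>C ** matrix_inv C = mat 1\<close> by (simp add: matrix_mul_assoc[symmetric])
    then show "A = L" by simp
  qed
  show ?thesis
    unfolding is_lmmse_estimate_def L_def[symmetric] using L uniq by blast
qed

section \<open>Independence and white noise\<close>

lemma (in prob_space) indep_rvsI:
  assumes "random_variable borel X" "random_variable borel Y"
    and "\<And>A B. A \<in> sets borel \<Longrightarrow> B \<in> sets borel \<Longrightarrow>
      prob ((X -` A \<inter> space M) \<inter> (Y -` B \<inter> space M)) = prob (X -` A \<inter> space M) * prob (Y -` B \<inter> space M)"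
  shows "indep_rvs M X Y"
  unfolding indep_rvs_def using assms
  by (intro conjI indep_setI) (auto intro: measurable_sets)

lemma (in prob_space) indep_rvsD:
  assumes "indep_rvs M X Y" "A \<in> sets borel" "B \<in> sets borel"
  shows "prob ((X -` A \<inter> space M) \<inter> (Y -` B \<inter> space M)) = prob (X -` A \<inter> space M) * prob (Y -` B \<inter> space M)"
  using assms unfolding indep_rvs_def by (blast intro: indep_setD)

lemma (in prob_space) indep_rvs_compose:
  fixes f :: "'b::topological_space \<Rightarrow> 'c::topological_space" and g :: "'d::topological_space \<Rightarrow> 'e::topological_space"
  assumes XY: "indep_rvs M X Y" and f: "f \<in> borel_measurable borel" and g: "g \<in> borel_measurable borel"
  shows "indep_rvs M (\<lambda>\<omega>. f (X \<omega>)) (\<lambda>\<omega>. g (Y \<omega>))"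
proof (rule indep_rvsI)
  have "X \<in> borel_measurable M" "Y \<in> borel_measurable M"
    using XY by (auto simp: indep_rvs_def)
  then show "random_variable borel (\<lambda>\<omega>. f (X \<omega>))" "random_variable borel (\<lambda>\<omega>. g (Y \<omega>))"
    using f g by (auto intro: measurable_compose)
  fix A :: "'c set" and B :: "'e set" assume "A \<in> sets borel" "B \<in> sets borel"
  then have "f -` A \<in> sets borel" "g -` B \<in> sets borel"
    using measurable_sets[OF f] measurable_sets[OF g] by auto
  from indep_rvsD[OF XY this]
  show "prob ((\<lambda>\<omega>. f (X \<omega>)) -` A \<inter> space M \<inter> ((\<lambda>\<omega>. g (Y \<omega>)) -` B \<inter> space M)) =
      prob ((\<lambda>\<omega>. f (X \<omega>)) -` A \<inter> space M) * prob ((\<lambda>\<omega>. g (Y \<omega>)) -` B \<inter> space M)"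
    by (simp add: vimage_def)
qed

lemma (in prob_space) indep_rvs_sym:
  assumes "indep_rvs M X Y"
  shows "indep_rvs M Y X"
proof (rule indep_rvsI)
  show "random_variable borel X" "random_variable borel Y"
    using assms by (auto simp: indep_rvs_def)
qed (simp add: indep_rvsD[OF assms] Int_commute[of "Y -` _ \<inter> _"] mult.commute)

lemma (in prob_space) indep_rvs_const:
  fixes X :: "'a \<Rightarrow> 'b::topological_space" and a :: "'c::topological_space"
  assumes "random_variable borel X"
  shows "indep_rvs M X (\<lambda>_. a)"
proof (rule indep_rvsI)
  fix A :: "'b set" and B :: "'c set"
  show "prob (X -` A \<inter> space M \<inter> ((\<lambda>_. a) -` B \<inter> space M)) =
      prob (X -` A \<inter> space M) * prob ((\<lambda>_. a) -` B \<inter> space M)"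
    by (cases "a \<in> B") (simp_all add: prob_space)
qed (use assms in auto)

text \<open>The preimages of Borel sets are stable under intersection, so independence extends to
  the generated sigma-algebras. For variables of one type this opens the product formula for
  expectations.\<close>

lemma (in prob_space) indep_rvs_indep_var:
  assumes XY: "indep_rvs M X Y"
  shows "indep_var borel X borel Y"
proof -
  have stable: "Int_stable {Z -` A \<inter> space M |A. A \<in> sets borel}" for Z :: "'a \<Rightarrow> 'b"
  proof (rule Int_stableI, safe)
    fix A B :: "'b set" assume "A \<in> sets borel" "B \<in> sets borel"
    then show "\<exists>C. (Z -` A \<inter> space M) \<inter> (Z -` B \<inter> space M) = Z -` C \<inter> space M \<and> C \<in> sets borel"
      by (intro exI[of _ "A \<inter> B"]) auto
  qed
  show ?thesis
    using XY unfolding indep_rvs_def indep_var_eq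
    by (auto intro: indep_set_sigma_sets stable)
qed

text \<open>Disjoint blocks of an independent family are independent, and so are functions of them.
  The two functions may have different codomains, as is required for a matrix and a vector assembled
  from scalar entries.\<close>

lemma (in prob_space) indep_vars_indep_rvs:
  fixes X :: "'i \<Rightarrow> 'a \<Rightarrow> 'b::topological_space"
    and f :: "('i \<Rightarrow> 'b) \<Rightarrow> 'c::topological_space" and g :: "('i \<Rightarrow> 'b) \<Rightarrow> 'd::topological_space"
  assumes X: "indep_vars (\<lambda>_. borel) X I" and AB: "A \<inter> B = {}" "A \<subseteq> I" "B \<subseteq> I"
    and f: "f \<in> borel_measurable (PiM A (\<lambda>_. borel))" and g: "g \<in> borel_measurable (PiM B (\<lambda>_. borel))"
  shows "indep_rvs M (\<lambda>\<omega>. f (\<lambda>i\<in>A. X i \<omega>)) (\<lambda>\<omega>. g (\<lambda>i\<in>B. X i \<omega>))"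
proof (rule indep_rvsI)
  let ?X = "\<lambda>A \<omega>. \<lambda>i\<in>A. X i \<omega>"
  have ind: "indep_var (PiM A (\<lambda>_. borel)) (?X A) (PiM B (\<lambda>_. borel)) (?X B)"
    by (rule indep_var_restrict[OF X AB])
  then have meas: "?X A \<in> measurable M (PiM A (\<lambda>_. borel))" "?X B \<in> measurable M (PiM B (\<lambda>_. borel))"
    by (auto simp: indep_var_eq)
  show "random_variable borel (\<lambda>\<omega>. f (?X A \<omega>))" "random_variable borel (\<lambda>\<omega>. g (?X B \<omega>))"
    using measurable_compose[OF meas(1) f] measurable_compose[OF meas(2) g] by auto
  have vim: "(\<lambda>\<omega>. h (?X C \<omega>)) -` S \<inter> space M = ?X C -` (h -` S \<inter> space (PiM C (\<lambda>_. borel))) \<inter> space M"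
    if "?X C \<in> measurable M (PiM C (\<lambda>_. borel))" for h :: "_ \<Rightarrow> 'z" and C S
    using measurable_space[OF that] by auto
  have gen: "?X C -` E \<inter> space M \<in> sigma_sets (space M) {?X C -` A \<inter> space M |A. A \<in> sets (PiM C (\<lambda>_. borel))}"
    if "E \<in> sets (PiM C (\<lambda>_. borel))" for C E
    using that by (intro sigma_sets.Basic) blast
  fix S :: "'c set" and T :: "'d set" assume ST: "S \<in> sets borel" "T \<in> sets borel"
  show "prob ((\<lambda>\<omega>. f (?X A \<omega>)) -` S \<inter> space M \<inter> ((\<lambda>\<omega>. g (?X B \<omega>)) -` T \<inter> space M)) =
      prob ((\<lambda>\<omega>. f (?X A \<omega>)) -` S \<inter> space M) * prob ((\<lambda>\<omega>. g (?X B \<omega>)) -` T \<inter> space M)"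
    unfolding vim[OF meas(1)] vim[OF meas(2)]
    by (intro indep_setD[OF ind[unfolded indep_var_eq, THEN conjunct2]] gen
        measurable_sets[OF f ST(1)] measurable_sets[OF g ST(2)])
qed

lemma (in prob_space) indep_vars_indep_rvs_pair:
  assumes "indep_vars (\<lambda>_. borel) X I" "i \<in> I" "j \<in> I" "i \<noteq> j"
  shows "indep_rvs M (X i) (X j)"
  using indep_vars_indep_rvs[OF assms(1), of "{i}" "{j}" "\<lambda>p. p i" "\<lambda>p. p j"] assms(2-)
  by simp

lemma (in prob_space) integral_mult_cnj_indep:
  fixes X Y :: "'a \<Rightarrow> complex"
  assumes "indep_rvs M X Y" "integrable M X" "integrable M Y"
  shows "(\<integral>\<omega>. X \<omega> * cnj (Y \<omega>) \<partial>M) = (\<integral>\<omega>. X \<omega> \<partial>M) * cnj (\<integral>\<omega>. Y \<omega> \<partial>M)"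
proof -
  have "cnj \<in> borel_measurable borel" by (intro borel_measurable_continuous_onI continuous_intros)
  from indep_rvs_compose[OF assms(1), of "\<lambda>x. x" cnj] this
  have "indep_rvs M X (\<lambda>\<omega>. cnj (Y \<omega>))" by simp
  from indep_var_lebesgue_integral[OF indep_rvs_indep_var[OF this]] assms(2,3)
  show ?thesis by simp
qed

lemma (in prob_space) integral_outer_indep:
  fixes u :: "'a \<Rightarrow> complex^'m" and v :: "'a \<Rightarrow> complex^'n"
  assumes ind: "indep_rvs M u v" and u: "square_integrable M u" and v: "square_integrable M v"
  shows "(\<integral>\<omega>. outer (u \<omega>) (v \<omega>) \<partial>M) = outer (\<integral>\<omega>. u \<omega> \<partial>M) (\<integral>\<omega>. v \<omega> \<partial>M)"
proof -
  have nth: "(\<lambda>x :: complex^'l. x $ i) \<in> borel_measurable borel" for i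
    by (intro borel_measurable_continuous_onI continuous_intros)
  have "(\<integral>\<omega>. u \<omega> $ i * cnj (v \<omega> $ j) \<partial>M) = (\<integral>\<omega>. u \<omega> $ i \<partial>M) * cnj (\<integral>\<omega>. v \<omega> $ j \<partial>M)" for i j
    by (intro integral_mult_cnj_indep square_integrable_integrable square_integrable_nth u v
        indep_rvs_compose[OF ind nth nth])
  then have "(\<integral>\<omega>. outer (u \<omega>) (v \<omega>) \<partial>M) $ i $ j = outer (\<integral>\<omega>. u \<omega> \<partial>M) (\<integral>\<omega>. v \<omega> \<partial>M) $ i $ j" for i j
    by (simp add: integral_outer_nth[OF u v])
       (simp add: outer_def integral_nth square_integrable_integrable u v)
  then show ?thesis by (simp add: vec_eq_iff)
qed

text \<open>In general a product of two L2 functions is merely in L1. Under independence the squared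
  moduli are independent and integrable, so their product is integrable too.\<close>

lemma (in prob_space) square_integrable_mult_indep:
  fixes X Y :: "'a \<Rightarrow> complex"
  assumes ind: "indep_rvs M X Y" and X: "square_integrable M X" and Y: "square_integrable M Y"
  shows "square_integrable M (\<lambda>\<omega>. X \<omega> * Y \<omega>)"
proof -
  have "(\<lambda>z::complex. (norm z)\<^sup>2) \<in> borel_measurable borel" by simp
  from indep_rvs_indep_var[OF indep_rvs_compose[OF ind this this]]
  have "integrable M (\<lambda>\<omega>. (norm (X \<omega>))\<^sup>2 * (norm (Y \<omega>))\<^sup>2)"
    using X Y by (intro indep_var_integrable) (auto simp: square_integrable_def)
  then show ?thesis
    using X Y by (simp add: square_integrable_def norm_mult power_mult_distrib borel_measurable_times)
qed

text \<open>Entry (i, j) of the second moment is a double sum over b and b' of moments of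
  \<open>D\<close> times moments of \<open>y\<close>. Whiteness removes all terms except those with
  i = j and b = b', and the surviving sum over b is the trace. A constant \<open>y\<close> is
  allowed, which covers the noise.\<close>

lemma (in prob_space) white_matrix_vector_mult:
  fixes D :: "'a \<Rightarrow> complex^'n^'m" and y :: "'a \<Rightarrow> complex^'n"
  assumes D: "\<And>a b. square_integrable M (\<lambda>\<omega>. D \<omega> $ a $ b)"
    and white: "\<And>a b a' b'. (\<integral>\<omega>. D \<omega> $ a $ b * cnj (D \<omega> $ a' $ b') \<partial>M) = (if a = a' \<and> b = b' then s else 0)"
    and y: "square_integrable M y" and ind: "indep_rvs M D y"
  shows "square_integrable M (\<lambda>\<omega>. D \<omega> *v y \<omega>)"
    and "(\<integral>\<omega>. outer (D \<omega> *v y \<omega>) (D \<omega> *v y \<omega>) \<partial>M)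
      = cscale (s * trace (\<integral>\<omega>. outer (y \<omega>) (y \<omega>) \<partial>M)) (mat 1)"
proof -
  have nth_meas: "(\<lambda>x :: complex^'n^'m. x $ a $ b) \<in> borel_measurable borel" for a b
    by (intro borel_measurable_continuous_onI continuous_intros)
  have nth_meas': "(\<lambda>x :: complex^'n. x $ b) \<in> borel_measurable borel" for b
    by (intro borel_measurable_continuous_onI continuous_intros)
  have Dy: "square_integrable M (\<lambda>\<omega>. D \<omega> $ a $ b * y \<omega> $ b)" for a b
    by (intro square_integrable_mult_indep D square_integrable_nth y
        indep_rvs_compose[OF ind nth_meas nth_meas'])
  show *: "square_integrable M (\<lambda>\<omega>. D \<omega> *v y \<omega>)"
    by (rule square_integrable_vec) (simp add: matrix_vector_mult_def square_integrable_sum Dy)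
  have prod: "(\<integral>\<omega>. (D \<omega> $ a $ b * y \<omega> $ b) * cnj (D \<omega> $ a' $ b' * y \<omega> $ b') \<partial>M)
      = (if a = a' \<and> b = b' then s else 0) * (\<integral>\<omega>. y \<omega> $ b * cnj (y \<omega> $ b') \<partial>M)" for a b a' b'
  proof -
    have "indep_rvs M (\<lambda>\<omega>. D \<omega> $ a $ b * cnj (D \<omega> $ a' $ b')) (\<lambda>\<omega>. y \<omega> $ b * cnj (y \<omega> $ b'))"
      by (rule indep_rvs_compose[OF ind, of "\<lambda>x. x $ a $ b * cnj (x $ a' $ b')" "\<lambda>x. x $ b * cnj (x $ b')"])
         (intro borel_measurable_continuous_onI continuous_intros)+
    moreover have "integrable M (\<lambda>\<omega>. D \<omega> $ a $ b * cnj (D \<omega> $ a' $ b'))"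
      by (intro square_integrable_bilinear[OF bounded_bilinear_mult] D
          square_integrable_bounded_linear[OF bounded_linear_cnj])
    moreover have "integrable M (\<lambda>\<omega>. y \<omega> $ b * cnj (y \<omega> $ b'))"
      by (intro square_integrable_bilinear[OF bounded_bilinear_mult] square_integrable_nth y
          square_integrable_bounded_linear[OF bounded_linear_cnj])
    ultimately have "(\<integral>\<omega>. (D \<omega> $ a $ b * cnj (D \<omega> $ a' $ b')) * (y \<omega> $ b * cnj (y \<omega> $ b')) \<partial>M)
        = (if a = a' \<and> b = b' then s else 0) * (\<integral>\<omega>. y \<omega> $ b * cnj (y \<omega> $ b') \<partial>M)"
      unfolding white[symmetric] by (intro indep_var_lebesgue_integral indep_rvs_indep_var)
    then show ?thesis by (simp add: mult_ac)
  qed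
  have int: "integrable M (\<lambda>\<omega>. (D \<omega> $ a $ b * y \<omega> $ b) * cnj (D \<omega> $ a' $ b' * y \<omega> $ b'))" for a b a' b'
    by (rule square_integrable_bilinear[OF bounded_bilinear_mult Dy
          square_integrable_bounded_linear[OF bounded_linear_cnj Dy]])
  have "(\<integral>\<omega>. outer (D \<omega> *v y \<omega>) (D \<omega> *v y \<omega>) \<partial>M) $ i $ j
      = (cscale (s * trace (\<integral>\<omega>. outer (y \<omega>) (y \<omega>) \<partial>M)) (mat 1)) $ i $ j" for i j
  proof -
    have "(\<integral>\<omega>. outer (D \<omega> *v y \<omega>) (D \<omega> *v y \<omega>) \<partial>M) $ i $ j
        = (\<integral>\<omega>. (\<Sum>b\<in>UNIV. \<Sum>b'\<in>UNIV. (D \<omega> $ i $ b * y \<omega> $ b) * cnj (D \<omega> $ j $ b' * y \<omega> $ b')) \<partial>M)"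
      unfolding integral_outer_nth[OF * *]
      by (simp add: matrix_vector_mult_def sum_product)
    also have "\<dots> = (\<Sum>b\<in>UNIV. \<Sum>b'\<in>UNIV. \<integral>\<omega>. (D \<omega> $ i $ b * y \<omega> $ b) * cnj (D \<omega> $ j $ b' * y \<omega> $ b') \<partial>M)"
      using int by (simp only: Bochner_Integration.integral_sum Bochner_Integration.integrable_sum)
    also have "\<dots> = (\<Sum>b\<in>UNIV. \<Sum>b'\<in>UNIV. if b' = b then (if i = j then s * (\<integral>\<omega>. y \<omega> $ b * cnj (y \<omega> $ b) \<partial>M) else 0) else 0)"
      unfolding prod by (intro sum.cong) auto
    also have "\<dots> = (if i = j then s * (\<Sum>b\<in>UNIV. \<integral>\<omega>. y \<omega> $ b * cnj (y \<omega> $ b) \<partial>M) else 0)"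
      by (simp add: sum_distrib_left)
    also have "\<dots> = (cscale (s * trace (\<integral>\<omega>. outer (y \<omega>) (y \<omega>) \<partial>M)) (mat 1)) $ i $ j"
      by (simp add: cscale_def mat_def trace_def integral_outer_nth[OF y y])
    finally show ?thesis .
  qed
  then show "(\<integral>\<omega>. outer (D \<omega> *v y \<omega>) (D \<omega> *v y \<omega>) \<partial>M)
      = cscale (s * trace (\<integral>\<omega>. outer (y \<omega>) (y \<omega>) \<partial>M)) (mat 1)"
    by (simp add: vec_eq_iff)
qed

section \<open>Moments of Gaussian scalars, vectors and matrices\<close>

lemma (in prob_space) std_complex_normal_moments:
  assumes X [measurable]: "random_variable borel X" and law: "distr M borel X = std_complex_normal"
  shows "square_integrable M X" "(\<integral>\<omega>. X \<omega> \<partial>M) = 0" "(\<integral>\<omega>. X \<omega> * cnj (X \<omega>) \<partial>M) = 1"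
proof -
  have "integrable (distr M borel X) (\<lambda>z. (cmod z)\<^sup>2)"
    unfolding law by (rule std_complex_normal_second_moment)
  then show sq: "square_integrable M X"
    by (simp add: square_integrable_def integrable_distr_eq)
  show "(\<integral>\<omega>. X \<omega> \<partial>M) = 0"
    using std_complex_normal_mean by (simp add: law[symmetric] integral_distr)
  have "(\<integral>\<omega>. (cmod (X \<omega>))\<^sup>2 \<partial>M) = 1"
    using std_complex_normal_second_moment(2) by (simp add: law[symmetric] integral_distr)
  then have "(\<integral>\<omega>. complex_of_real ((cmod (X \<omega>))\<^sup>2) \<partial>M) = 1"
    by (simp only: integral_complex_of_real of_real_1)
  then show "(\<integral>\<omega>. X \<omega> * cnj (X \<omega>) \<partial>M) = 1"
    by (simp only: complex_norm_square)
qed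

lemma (in prob_space) std_complex_normal_white:
  assumes rv: "\<And>i. random_variable borel (X i)" and law: "\<And>i. distr M borel (X i) = std_complex_normal"
    and ind: "\<And>i j. i \<noteq> j \<Longrightarrow> indep_rvs M (X i) (X j)"
  shows "(\<integral>\<omega>. X i \<omega> * cnj (X j \<omega>) \<partial>M) = (if i = j then 1 else 0)"
proof (cases "i = j")
  case False
  note m = std_complex_normal_moments[OF rv law]
  have "(\<integral>\<omega>. X i \<omega> * cnj (X j \<omega>) \<partial>M) = (\<integral>\<omega>. X i \<omega> \<partial>M) * cnj (\<integral>\<omega>. X j \<omega> \<partial>M)"
    by (intro integral_mult_cnj_indep square_integrable_integrable m ind False)
  then show ?thesis using m(2) False by simp
qed (simp add: std_complex_normal_moments[OF rv law])

lemma (in prob_space) std_complex_normal_vector: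
  fixes X :: "'a \<Rightarrow> complex^'n"
  assumes rv: "\<And>i. random_variable borel (\<lambda>\<omega>. X \<omega> $ i)"
    and law: "\<And>i. distr M borel (\<lambda>\<omega>. X \<omega> $ i) = std_complex_normal"
    and ind: "\<And>i j. i \<noteq> j \<Longrightarrow> indep_rvs M (\<lambda>\<omega>. X \<omega> $ i) (\<lambda>\<omega>. X \<omega> $ j)"
  shows "square_integrable M X" "(\<integral>\<omega>. X \<omega> \<partial>M) = 0" "(\<integral>\<omega>. outer (X \<omega>) (X \<omega>) \<partial>M) = mat 1"
proof -
  note m = std_complex_normal_moments[OF rv law]
  show sq: "square_integrable M X" by (rule square_integrable_vec) (rule m)
  show "(\<integral>\<omega>. X \<omega> \<partial>M) = 0"
    using m(2) by (simp add: vec_eq_iff integral_nth square_integrable_integrable[OF sq])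
  show "(\<integral>\<omega>. outer (X \<omega>) (X \<omega>) \<partial>M) = mat 1"
    using std_complex_normal_white[of "\<lambda>i \<omega>. X \<omega> $ i", OF rv law ind]
    by (simp add: vec_eq_iff integral_outer_nth[OF sq sq] mat_def)
qed

text \<open>By definition of \<open>complex_normal\<close> the law of \<open>w\<close> is that of
  \<open>S g\<close> on a product space, with \<open>S\<close> the root of \<open>C\<close> and
  \<open>g\<close> white. There the second moment is \<open>S\<close> times its conjugate transpose,
  which is \<open>C\<close> because \<open>S\<close> is Hermitian.\<close>

lemma (in prob_space) complex_normal_moments:
  fixes w :: "'a \<Rightarrow> complex^'n"
  assumes w [measurable]: "random_variable borel w" and law: "distr M borel w = complex_normal C" and C: "psd C"
  shows "square_integrable M w" "(\<integral>\<omega>. w \<omega> \<partial>M) = 0" "(\<integral>\<omega>. outer (w \<omega>) (w \<omega>) \<partial>M) = C"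
proof -
  define N where "N = Pi\<^sub>M (UNIV :: 'n set) (\<lambda>_. std_complex_normal)"
  interpret N: prob_space N
    unfolding N_def by (rule prob_space_PiM) (rule prob_space_std_complex_normal)
  have coord [measurable]: "(\<lambda>p. p i) \<in> borel_measurable N" for i
    using measurable_component_singleton[of i UNIV "\<lambda>_. std_complex_normal"]
    by (simp add: N_def cong: measurable_cong_sets)
  have coord_law: "distr N borel (\<lambda>p. p i) = std_complex_normal" for i
    using distr_PiM_component[of UNIV "\<lambda>_. std_complex_normal" i] prob_space_std_complex_normal
    by (simp add: N_def cong: distr_cong)
  have "N.indep_vars (\<lambda>_. borel) (\<lambda>i p. p i) UNIV"
  \<comment> \<open>The joint law of the coordinates is the product measure itself, whose factors
    are their marginals.\<close>
  proof (subst N.indep_vars_iff_distr_eq_PiM)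
    have "distr N (Pi\<^sub>M UNIV (\<lambda>_. borel)) (\<lambda>p. p) = distr N N (\<lambda>p. p)"
      by (rule distr_cong) (auto simp: N_def cong: sets_PiM_cong)
    also have "\<dots> = N" by (simp add: distr_id2)
    finally show "distr N (Pi\<^sub>M UNIV (\<lambda>_. borel)) (\<lambda>p. \<lambda>i\<in>UNIV. p i) = Pi\<^sub>M UNIV (\<lambda>i. distr N borel (\<lambda>p. p i))"
      unfolding coord_law by (simp add: N_def restrict_UNIV)
  qed auto
  from N.indep_vars_indep_rvs_pair[OF this]
  have "indep_rvs N (\<lambda>p. p i) (\<lambda>p. p j)" if "i \<noteq> j" for i j
    using that by blast
  then have g: "square_integrable N (\<lambda>p. \<chi> i. p i)" "(\<integral>p. (\<chi> i. p i) \<partial>N) = (0 :: complex^'n)"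
    "(\<integral>p. outer (\<chi> i. p i) (\<chi> i. p i) \<partial>N) = (mat 1 :: complex^'n^'n)"
    using N.std_complex_normal_vector[of "\<lambda>p. \<chi> i. p i"] coord_law by simp_all
  define S where "S = psd_sqrt C"
  have S: "S ** S = C" "ctranspose S = S" using psd_sqrt[OF C] by (auto simp: S_def psd_def)
  let ?G = "\<lambda>p. S *v (\<chi> i. p i)"
  have G: "square_integrable N ?G" by (rule square_integrable_matrix_vector_mult[OF g(1)])
  note [measurable] = square_integrable_measurable[OF G]
  have law': "distr M borel w = distr N borel ?G"
    by (simp add: law complex_normal_def S_def N_def)
  have outer_meas: "(\<lambda>x :: complex^'n. outer x x) \<in> borel_measurable borel"
    by (intro borel_measurable_continuous_onI bounded_bilinear.continuous_on[OF bounded_bilinear_outer] continuous_intros)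
  have "integrable (distr M borel w) (\<lambda>x. (norm x)\<^sup>2)"
    unfolding law' using G by (simp add: integrable_distr_eq square_integrable_def)
  then show "square_integrable M w"
    by (simp add: integrable_distr_eq square_integrable_def)
  \<comment> \<open>\<open>w\<close> and \<open>?G\<close> live on different probability spaces;
    having the same law, they give the same expectation to every Borel function.\<close>
  have transfer: "(\<integral>\<omega>. f (w \<omega>) \<partial>M) = (\<integral>p. f (?G p) \<partial>N)"
    if "f \<in> borel_measurable borel" for f :: "complex^'n \<Rightarrow> 'z::{banach, second_countable_topology}"
    using integral_distr[OF w that] integral_distr[OF square_integrable_measurable[OF G] that]
    unfolding law' by (rule trans[OF sym])
  have "(\<integral>\<omega>. w \<omega> \<partial>M) = (\<integral>p. ?G p \<partial>N)"
    by (rule transfer) simp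
  also have "\<dots> = S *v (\<integral>p. (\<chi> i. p i) \<partial>N)"
    by (rule integral_bounded_linear[OF matrix_vector_mul_bounded_linear N.square_integrable_integrable[OF g(1)]])
  finally show "(\<integral>\<omega>. w \<omega> \<partial>M) = 0" by (simp add: g(2))
  have "(\<integral>\<omega>. outer (w \<omega>) (w \<omega>) \<partial>M) = (\<integral>p. outer (?G p) (?G p) \<partial>N)"
    by (rule transfer[OF outer_meas])
  also have "\<dots> = C"
    by (simp add: integral_outer_matrix_vector_mult[OF g(1) g(1)] g(3) S)
  finally show "(\<integral>\<omega>. outer (w \<omega>) (w \<omega>) \<partial>M) = C" .
qed

lemma psd_scaleR_mat_1:
  assumes "s \<ge> 0"
  shows "psd (s *\<^sub>R mat 1 :: complex^'n^'n)"
  using assms by (simp add: psd_iff_inner scaleR_matrix_vector_mult)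

text \<open>Entries in one column are uncorrelated because the column covariance is a multiple of
  the identity, entries in different columns because the columns are independent and
  centred.\<close>

lemma (in prob_space) indep_columns_white:
  fixes W :: "'a \<Rightarrow> complex^'t^'m"
  assumes W: "W \<in> borel_measurable M"
    and indep: "indep_vars (\<lambda>_. borel) (\<lambda>t \<omega>. column t (W \<omega>)) UNIV"
    and law: "\<And>t. distr M borel (\<lambda>\<omega>. column t (W \<omega>)) = complex_normal (s *\<^sub>R mat 1)"
    and s: "s \<ge> 0"
  shows "square_integrable M (\<lambda>\<omega>. W \<omega> $ a $ b)" "(\<integral>\<omega>. W \<omega> $ a $ b \<partial>M) = 0"
    and "(\<integral>\<omega>. W \<omega> $ a $ b * cnj (W \<omega> $ a' $ b') \<partial>M) = (if a = a' \<and> b = b' then complex_of_real s else 0)"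
proof -
  have "random_variable borel (\<lambda>\<omega>. column t (W \<omega>))" for t
    using indep by (auto simp: indep_vars_def)
  note m = complex_normal_moments[OF this law psd_scaleR_mat_1[OF s]]
  have nth: "W \<omega> $ a $ b = column b (W \<omega>) $ a" for \<omega> a b by (simp add: column_def)
  have sq: "square_integrable M (\<lambda>\<omega>. W \<omega> $ a $ b)" for a b
    unfolding nth by (rule square_integrable_nth) (rule m)
  have mean: "(\<integral>\<omega>. W \<omega> $ a $ b \<partial>M) = 0" for a b
    unfolding nth by (simp add: integral_nth[OF square_integrable_integrable[OF m(1)], symmetric] m(2))
  show "square_integrable M (\<lambda>\<omega>. W \<omega> $ a $ b)" "(\<integral>\<omega>. W \<omega> $ a $ b \<partial>M) = 0"
    by (fact sq mean)+
  show "(\<integral>\<omega>. W \<omega> $ a $ b * cnj (W \<omega> $ a' $ b') \<partial>M) = (if a = a' \<and> b = b' then complex_of_real s else 0)"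
  proof (cases "b = b'")
    case True
    have "(\<integral>\<omega>. column b (W \<omega>) $ a * cnj (column b (W \<omega>) $ a') \<partial>M) = (s *\<^sub>R mat 1 :: complex^'m^'m) $ a $ a'"
      using integral_outer_nth[OF m(1) m(1), of b b a a'] by (simp only: m(3))
    then show ?thesis using True by (simp add: nth mat_def scaleR_conv_of_real[where 'a = complex])
  next
    case False
    have "(\<lambda>x :: complex^'m. x $ i) \<in> borel_measurable borel" for i
      by (intro borel_measurable_continuous_onI continuous_intros)
    from indep_rvs_compose[OF indep_vars_indep_rvs_pair[OF indep UNIV_I UNIV_I False] this[of a] this[of a']]
    have "(\<integral>\<omega>. W \<omega> $ a $ b * cnj (W \<omega> $ a' $ b') \<partial>M) = (\<integral>\<omega>. W \<omega> $ a $ b \<partial>M) * cnj (\<integral>\<omega>. W \<omega> $ a' $ b' \<partial>M)"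
      by (intro integral_mult_cnj_indep square_integrable_integrable sq) (simp add: nth)
    then show ?thesis using False by (simp add: mean)
  qed
qed

text \<open>The entries of \<open>D\<close> and those of \<open>c k\<close> are disjoint blocks of
  one independent family, so \<open>D\<close> as a whole is independent of \<open>T *v c k\<close>.
  The trace arises because the second moment of \<open>T *v c k\<close> is
  \<open>T ** ctranspose T\<close>.\<close>

lemma (in prob_space) matrix_vector_white:
  fixes D :: "'a \<Rightarrow> complex^'n^'m" and c :: "'k \<Rightarrow> 'a \<Rightarrow> complex^'n"
  assumes indep: "indep_vars (\<lambda>_. borel)
        (\<lambda>e \<omega>. case e of Inl (a, b) \<Rightarrow> D \<omega> $ a $ b | Inr (k, b) \<Rightarrow> c k \<omega> $ b)
        (UNIV :: ('m \<times> 'n + 'k \<times> 'n) set)"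
    and D_law: "\<And>a b. distr M borel (\<lambda>\<omega>. D \<omega> $ a $ b) = std_complex_normal"
    and c_law: "\<And>k b. distr M borel (\<lambda>\<omega>. c k \<omega> $ b) = std_complex_normal"
  shows "square_integrable M (\<lambda>\<omega>. D \<omega> *v (T *v c k \<omega>))"
    and "(\<integral>\<omega>. outer (D \<omega> *v (T *v c k \<omega>)) (D \<omega> *v (T *v c k \<omega>)) \<partial>M)
      = cscale (trace (T ** ctranspose T)) (mat 1)"
proof -
  define X where "X e \<omega> = (case e of Inl (a, b) \<Rightarrow> D \<omega> $ a $ b | Inr (k, b) \<Rightarrow> c k \<omega> $ b)"
    for e :: "'m \<times> 'n + 'k \<times> 'n" and \<omega>
  have X_simps: "X (Inl (a, b)) = (\<lambda>\<omega>. D \<omega> $ a $ b)" "X (Inr (k, b)) = (\<lambda>\<omega>. c k \<omega> $ b)" for a b k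
    by (simp_all add: X_def fun_eq_iff)
  have X_indep: "indep_vars (\<lambda>_. borel) X UNIV"
    using indep unfolding X_def[abs_def] .
  then have rv: "random_variable borel (X e)" for e
    by (auto simp: indep_vars_def)
  have law: "distr M borel (X e) = std_complex_normal" for e
    using D_law c_law by (cases e) (auto simp: X_simps)
  have pair: "indep_rvs M (X e) (X e')" if "e \<noteq> e'" for e e'
    by (rule indep_vars_indep_rvs_pair[OF X_indep UNIV_I UNIV_I that])
  note white = std_complex_normal_white[of X, OF rv law pair]
  have c: "square_integrable M (c k)" "(\<integral>\<omega>. outer (c k \<omega>) (c k \<omega>) \<partial>M) = mat 1"
    using std_complex_normal_vector[of "c k"] rv[of "Inr (k, _)"] law[of "Inr (k, _)"]
      pair[of "Inr (k, _)" "Inr (k, _)"] by (simp_all add: X_simps)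
  have Dsq: "square_integrable M (\<lambda>\<omega>. D \<omega> $ a $ b)" for a b
    using std_complex_normal_moments(1)[OF rv law, of "Inl (a, b)"] by (simp add: X_simps)
  have Dwhite: "(\<integral>\<omega>. D \<omega> $ a $ b * cnj (D \<omega> $ a' $ b') \<partial>M) = (if a = a' \<and> b = b' then 1 else 0)" for a b a' b'
    using white[of "Inl (a, b)" "Inl (a', b')"] by (simp add: X_simps)
  let ?A = "range Inl :: ('m \<times> 'n + 'k \<times> 'n) set" and ?B = "range (\<lambda>b. Inr (k, b)) :: ('m \<times> 'n + 'k \<times> 'n) set"
  have "(\<lambda>p. (\<chi> a b. p (Inl (a, b))) :: complex^'n^'m) \<in> borel_measurable (PiM ?A (\<lambda>_. borel))"
    by (intro borel_measurable_vec) (simp add: measurable_component_singleton)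
  moreover have "(\<lambda>p. (\<chi> b. p (Inr (k, b))) :: complex^'n) \<in> borel_measurable (PiM ?B (\<lambda>_. borel))"
    by (intro borel_measurable_vec) (simp add: measurable_component_singleton)
  ultimately have "indep_rvs M (\<lambda>\<omega>. (\<chi> a b. (\<lambda>i\<in>?A. X i \<omega>) (Inl (a, b))) :: complex^'n^'m)
      (\<lambda>\<omega>. (\<chi> b. (\<lambda>i\<in>?B. X i \<omega>) (Inr (k, b))) :: complex^'n)"
    by (intro indep_vars_indep_rvs[OF X_indep]) auto
  then have "indep_rvs M D (c k)" by (simp add: X_simps)
  moreover have "(\<lambda>x. T *v x) \<in> borel_measurable borel"
    by (intro borel_measurable_continuous_onI continuous_intros)
  ultimately have ind: "indep_rvs M D (\<lambda>\<omega>. T *v c k \<omega>)"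
    using indep_rvs_compose[of D "c k" "\<lambda>x. x" "\<lambda>x. T *v x"] by simp
  have Tc: "square_integrable M (\<lambda>\<omega>. T *v c k \<omega>)"
    by (rule square_integrable_matrix_vector_mult[OF c(1)])
  show "square_integrable M (\<lambda>\<omega>. D \<omega> *v (T *v c k \<omega>))"
    by (rule white_matrix_vector_mult(1)[OF Dsq Dwhite Tc ind])
  show "(\<integral>\<omega>. outer (D \<omega> *v (T *v c k \<omega>)) (D \<omega> *v (T *v c k \<omega>)) \<partial>M)
      = cscale (trace (T ** ctranspose T)) (mat 1)"
    using white_matrix_vector_mult(2)[OF Dsq Dwhite Tc ind]
    by (simp add: integral_outer_matrix_vector_mult[OF c(1) c(1)] c(2))
qed

section \<open>The cascaded channel and its LMMSE estimator\<close>

theorem proposition1: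
  fixes P :: "'w measure"
    and Rb :: "complex^'m^'m" and Rs \<Theta> :: "complex^'n^'n"
    and \<delta>g :: real and \<delta>h :: "'k::finite \<Rightarrow> real"
    and D :: "'w \<Rightarrow> complex^'n^'m" and c :: "'k \<Rightarrow> 'w \<Rightarrow> complex^'n"
    and G :: "'w \<Rightarrow> complex^'n^'m" and h :: "'k \<Rightarrow> 'w \<Rightarrow> complex^'n"
    and u :: "'k \<Rightarrow> 'w \<Rightarrow> complex^'m"
    and x :: "'k \<Rightarrow> complex^'t" and \<tau> p_train \<sigma> :: real
    and W Y :: "'w \<Rightarrow> complex^'t^'m" and r :: "'k \<Rightarrow> 'w \<Rightarrow> complex^'m"
    and R Q :: "'k \<Rightarrow> complex^'m^'m"
    and k :: 'k
  assumes P: "prob_space P"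
    and Rb: "psd Rb" and Rs: "psd Rs"
    and \<delta>g: "\<delta>g > 0" and \<delta>h: "\<And>k. \<delta>h k > 0"
    and \<Theta>: "diagonal_matrix \<Theta>"
    and Dc_indep: "prob_space.indep_vars P (\<lambda>_. borel)
          (\<lambda>e \<omega>. case e of Inl (a, b) \<Rightarrow> D \<omega> $ a $ b | Inr (k, b) \<Rightarrow> c k \<omega> $ b)
          (UNIV :: ('m \<times> 'n + 'k \<times> 'n) set)"
    and D_law: "\<And>a b. distr P borel (\<lambda>\<omega>. D \<omega> $ a $ b) = std_complex_normal"
    and c_law: "\<And>k b. distr P borel (\<lambda>\<omega>. c k \<omega> $ b) = std_complex_normal"
    and G: "\<And>\<omega>. G \<omega> = sqrt \<delta>g *\<^sub>R (psd_sqrt Rb ** D \<omega> ** psd_sqrt Rs)"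
    and h: "\<And>k \<omega>. h k \<omega> = sqrt (\<delta>h k) *\<^sub>R (psd_sqrt Rs *v c k \<omega>)"
    and u: "\<And>k \<omega>. u k \<omega> = G \<omega> *v (\<Theta> *v h k \<omega>)"
    and \<tau>: "\<tau> = real CARD('t)"
    and pilots_orth: "\<And>k l. k \<noteq> l \<Longrightarrow> cinner (x k) (x l) = 0"
    and pilots_power: "\<And>k. cinner (x k) (x k) = complex_of_real (\<tau> * p_train)"
    and power_pos: "\<tau> * p_train > 0"
    and \<sigma>: "\<sigma>\<^sup>2 > 0"
    and W_indep: "prob_space.indep_vars P (\<lambda>_. borel) (\<lambda>t \<omega>. column t (W \<omega>)) UNIV"
    and W_law: "\<And>t. distr P borel (\<lambda>\<omega>. column t (W \<omega>)) = complex_normal (\<sigma>\<^sup>2 *\<^sub>R mat 1)"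
    and W_channels: "indep_rvs P W (\<lambda>\<omega>. (G \<omega>, \<chi> k. h k \<omega>))"
    and Y: "\<And>\<omega>. Y \<omega> = (\<Sum>i\<in>UNIV. outer (u i \<omega>) (x i)) + W \<omega>"
    and r: "\<And>k \<omega>. r k \<omega> = (1 / (\<tau> * p_train)) *\<^sub>R (Y \<omega> *v x k)"
    and R: "\<And>k. R k = (\<integral>\<omega>. outer (u k \<omega>) (u k \<omega>) \<partial>P)"
    and Q: "\<And>k. Q k = matrix_inv (R k + (\<sigma>\<^sup>2 / (\<tau> * p_train)) *\<^sub>R mat 1)"
  shows "R k = cscale (complex_of_real (\<delta>g * \<delta>h k) * trace (Rs ** \<Theta> ** Rs ** ctranspose \<Theta>)) Rb
    \<and> invertible (R k + (\<sigma>\<^sup>2 / (\<tau> * p_train)) *\<^sub>R mat 1)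
    \<and> (\<forall>u_hat. is_lmmse_estimate P (u k) (r k) u_hat \<longleftrightarrow> u_hat = (\<lambda>\<omega>. (R k ** Q k) *v r k \<omega>))"
proof -
  interpret prob_space P by fact
  let ?s = "\<sigma>\<^sup>2 / (\<tau> * p_train)"
  let ?z = "complex_of_real (\<delta>g * \<delta>h k) * trace (Rs ** \<Theta> ** Rs ** ctranspose \<Theta>)"
  define Sb where "Sb = psd_sqrt Rb"
  define Ss where "Ss = psd_sqrt Rs"
  have Sb: "Sb ** Sb = Rb" "ctranspose Sb = Sb" and Ss: "Ss ** Ss = Rs" "ctranspose Ss = Ss"
    using psd_sqrt[OF Rb] psd_sqrt[OF Rs] by (auto simp: Sb_def Ss_def psd_def)
  define A where "A = sqrt \<delta>g *\<^sub>R Sb"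
  \<comment> \<open>The left factor \<open>Ss\<close> comes from \<open>G\<close> and the right one
    from \<open>h k\<close>: this is everything deterministic between \<open>D\<close> and
    \<open>c k\<close>.\<close>
  define T where "T = sqrt (\<delta>h k) *\<^sub>R (Ss ** \<Theta> ** Ss)"
  have u_eq: "u k = (\<lambda>\<omega>. A *v (D \<omega> *v (T *v c k \<omega>)))"
    by (simp add: fun_eq_iff u G h A_def T_def Sb_def Ss_def scaleR_matrix_vector_mult
        matrix_vector_mult_scaleR_right matrix_vector_mul_assoc matrix_mult_scaleR matrix_mul_assoc)
  note Dc = matrix_vector_white[OF Dc_indep D_law c_law, of T k]
  have u_sq: "square_integrable P (u k)"
    unfolding u_eq by (rule square_integrable_matrix_vector_mult[OF Dc(1)])
  have AA: "A ** ctranspose A = \<delta>g *\<^sub>R Rb"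
    using \<delta>g by (simp add: A_def ctranspose_scaleR matrix_mult_scaleR Sb)
  have TT: "trace (T ** ctranspose T) = complex_of_real (\<delta>h k) * trace (Rs ** \<Theta> ** Rs ** ctranspose \<Theta>)"
  proof -
    have "T ** ctranspose T = \<delta>h k *\<^sub>R (Ss ** (\<Theta> ** Rs ** ctranspose \<Theta> ** Ss))"
      using \<delta>h[of k] by (simp add: T_def ctranspose_scaleR ctranspose_matrix_mult matrix_mult_scaleR Ss(2)
          matrix_mul_assoc Ss(1)[symmetric])
    \<comment> \<open>Cyclicity of the trace brings the two outer roots together, where they
      multiply to \<open>Rs\<close>.\<close>
    also have "trace \<dots> = complex_of_real (\<delta>h k) * trace (\<Theta> ** Rs ** ctranspose \<Theta> ** Ss ** Ss)"
      by (simp only: trace_scaleR trace_mul_sym[of Ss])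
    also have "\<dots> = complex_of_real (\<delta>h k) * trace (\<Theta> ** Rs ** ctranspose \<Theta> ** Rs)"
      by (simp only: matrix_mul_assoc[symmetric] Ss(1))
    also have "\<dots> = complex_of_real (\<delta>h k) * trace (Rs ** \<Theta> ** Rs ** ctranspose \<Theta>)"
      by (simp only: trace_mul_sym[of _ Rs] matrix_mul_assoc)
    finally show ?thesis .
  qed
  have R_eq: "R k = cscale ?z Rb"
  proof -
    have "R k = A ** cscale (trace (T ** ctranspose T)) (mat 1) ** ctranspose A"
      by (simp add: R u_eq integral_outer_matrix_vector_mult[OF Dc(1) Dc(1)] Dc(2))
    then show ?thesis
      by (simp add: matrix_mult_cscale_mat_1 cscale_matrix_mult AA cscale_scaleR TT mult_ac)
  qed
  have inv: "invertible (R k + ?s *\<^sub>R mat 1)"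
  proof (rule invertible_psd_add_pos)
    \<comment> \<open>Reading this off the second moment avoids having to determine the sign of the
      complex trace factor in \<open>R_eq\<close>.\<close>
    show "psd (R k)" unfolding R by (rule psd_integral_outer[OF u_sq])
    show "?s > 0" using \<sigma> power_pos by (rule divide_pos_pos)
  qed

  have nz: "\<tau> \<noteq> 0" "p_train \<noteq> 0" using power_pos by auto
  \<comment> \<open>Projecting on the pilot leaves the noise matrix applied to this deterministic
    vector.\<close>
  define y where "y = (1 / (\<tau> * p_train)) *\<^sub>R x k"
  define n where "n \<omega> = W \<omega> *v y" for \<omega>
  have r_eq: "r k = (\<lambda>\<omega>. u k \<omega> + n \<omega>)"
  proof
    fix \<omega>
    have "(\<Sum>i\<in>UNIV. cinner (x i) (x k) *s u i \<omega>) = (\<Sum>i\<in>UNIV. if i = k then (\<tau> * p_train) *\<^sub>R u k \<omega> else 0)"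
      by (intro sum.cong) (auto simp: pilots_orth pilots_power vec_eq_iff scaleR_conv_of_real[where 'a = complex])
    then have "Y \<omega> *v x k = (\<tau> * p_train) *\<^sub>R u k \<omega> + W \<omega> *v x k"
      by (simp add: Y matrix_vector_mult_add_rdistrib sum_matrix_vector_mult outer_vector_mult)
    then show "r k \<omega> = u k \<omega> + n \<omega>"
      using nz by (simp add: r n_def y_def matrix_vector_mult_scaleR_right scaleR_add_right)
  qed
  have W_meas: "W \<in> borel_measurable P" using W_channels by (simp add: indep_rvs_def)
  note W_white = indep_columns_white[OF W_meas W_indep W_law zero_le_power2]
  note n_moments = white_matrix_vector_mult[OF W_white(1) W_white(3) square_integrable_const indep_rvs_const[OF W_meas], of y]
  have n_sq: "square_integrable P n"
    using n_moments(1) by (simp add: n_def[abs_def])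
  have n_cov: "(\<integral>\<omega>. outer (n \<omega>) (n \<omega>) \<partial>P) = ?s *\<^sub>R mat 1"
  proof -
    \<comment> \<open>The normalisation contributes the inverse square of
      \<open>\<tau> * p_train\<close> and the pilot energy one factor of it, which leaves the single
      power in the noise level.\<close>
    have "trace (outer y y) = cinner (x k) (x k) / (of_real (\<tau> * p_train))\<^sup>2"
      by (simp add: trace_def outer_def y_def cinner_def sum_divide_distrib power2_eq_square scaleR_conv_of_real[where 'a = complex] mult_ac)
    also have "\<dots> = 1 / of_real (\<tau> * p_train)"
      using power_pos by (simp add: pilots_power power2_eq_square)
    finally show ?thesis
      using n_moments(2) by (simp add: n_def prob_space cscale_def vec_eq_iff mat_def scaleR_conv_of_real[where 'a = complex])
  qed
  have n_mean: "(\<integral>\<omega>. n \<omega> \<partial>P) = 0"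
  proof -
    have "(\<integral>\<omega>. n \<omega> $ i \<partial>P) = 0" for i
      using square_integrable_integrable[OF W_white(1)]
      by (simp add: n_def matrix_vector_mult_def Bochner_Integration.integral_sum W_white(2))
    then show ?thesis
      by (simp add: vec_eq_iff integral_nth[OF square_integrable_integrable[OF n_sq]])
  qed
  have n_u: "indep_rvs P n (u k)"
  proof -
    have "(\<lambda>V :: complex^'t^'m. V *v y) \<in> borel_measurable borel"
      by (intro borel_measurable_continuous_onI continuous_intros)
    \<comment> \<open>\<open>u k\<close> is a continuous function of the pair of \<open>G\<close>
      and all \<open>h\<close>, so independence of the noise from that pair passes to
      \<open>u k\<close>.\<close>
    moreover have "(\<lambda>p :: (complex^'n^'m) \<times> ((complex^'n)^'k). fst p *v (\<Theta> *v (snd p $ k))) \<in> borel_measurable borel"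
      by (intro borel_measurable_continuous_onI continuous_intros)
    ultimately have "indep_rvs P (\<lambda>\<omega>. W \<omega> *v y) (\<lambda>\<omega>. fst (G \<omega>, \<chi> k. h k \<omega>) *v (\<Theta> *v (snd (G \<omega>, \<chi> k. h k \<omega>) $ k)))"
      by (rule indep_rvs_compose[OF W_channels])
    moreover have "(\<lambda>\<omega>. fst (G \<omega>, \<chi> k. h k \<omega>) *v (\<Theta> *v (snd (G \<omega>, \<chi> k. h k \<omega>) $ k))) = u k"
      by (simp add: u fun_eq_iff)
    ultimately show ?thesis by (simp add: n_def[abs_def])
  qed
  have outer_zero: "outer a 0 = 0" "outer 0 a = 0" for a :: "complex^'m"
    by (simp_all add: outer_def vec_eq_iff)
  have nu: "(\<integral>\<omega>. outer (n \<omega>) (u k \<omega>) \<partial>P) = 0" "(\<integral>\<omega>. outer (u k \<omega>) (n \<omega>) \<partial>P) = 0"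
    using integral_outer_indep[OF n_u n_sq u_sq] integral_outer_indep[OF indep_rvs_sym[OF n_u] u_sq n_sq]
    by (simp_all add: n_mean outer_zero)
  have r_sq: "square_integrable P (r k)"
    unfolding r_eq by (rule square_integrable_add[OF u_sq n_sq])
  note int = integrable_outer[OF u_sq u_sq] integrable_outer[OF u_sq n_sq]
    integrable_outer[OF n_sq u_sq] integrable_outer[OF n_sq n_sq]
  note outer_add = bounded_bilinear.add_left[OF bounded_bilinear_outer] bounded_bilinear.add_right[OF bounded_bilinear_outer]
  have "(\<integral>\<omega>. outer (u k \<omega>) (r k \<omega>) \<partial>P) = R k"
    using int by (simp add: r_eq outer_add nu R)
  moreover have "(\<integral>\<omega>. outer (r k \<omega>) (r k \<omega>) \<partial>P) = R k + ?s *\<^sub>R mat 1"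
    using int by (simp add: r_eq outer_add nu R n_cov)
  ultimately have "is_lmmse_estimate P (u k) (r k) v \<longleftrightarrow> v = (\<lambda>\<omega>. (R k ** Q k) *v r k \<omega>)" for v
    unfolding Q by (rule is_lmmse_estimate_iff[OF u_sq r_sq _ _ inv])
  with R_eq inv show ?thesis by blast
qed

end
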